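(* Let $d\in\mathbb{N}$, let $\Omega\subset\mathbb{R}^d$ be a bounded open domain with $\mathcal{C}^1$ boundary and outer unit normal $\nu$, and let $f\in\mathcal{C}^1(\mathbb{R}^d;\mathbb{R}^d)$ satisfy $\nu(x)^\top f(x)\le 0$ for all $x\in\partial\Omega$. Let $w:\Omega\to\mathbb{R}_+$ be a measurable weight with $w^{-1}\in W^{1,\infty}(\Omega)$, and assume $f_i\in \mathrm{L}^\infty_w(\Omega)\cap\mathcal{C}^1(\bar\Omega)$ for $i=1,\dots,d$ and $\operatorname{ess\,sup}_{x\in\Omega}-\frac{f(x)^\top\nabla w(x)}{w(x)}<\infty$. Let $X=\mathrm{L}^1_w(\Omega)$, $X^*=\mathrm{L}^\infty_w(\Omega)$, $H=\mathrm{L}^2_{w^2}(\Omega)$, and let $S(t)$ be the preadjoint on $X$ of the composition semigroup $S^*(t)\varphi=\varphi\circ\Phi^t$ on $X^*$. Let $g$ be a nuclear cost, $g(x)=\sum_{i=1}^\infty c_i(x)^2$ for all $x\in\Omega$, with $c_i\in X^*$ and $\sum_{i=1}^\infty\|c_i\|_{X^*}^2<\infty$. If $S(t)$ is exponentially stable over $X$ with rate $\omega_0<0$, then the Lyapunov function $$v(z)=\int_0^\infty g(\Phi^t(z))\,dt$$ exists and it coincides with the sum of squares solution almost everywhere, i.e. $v(z)=\sum_{i=1}^\infty p_i(z)^2$ for almost every $z\in\Omega$, where $p_i\in X^*$ with $\sum_{i=1}^\infty\|p_i\|_H^2<\infty$ are the elements of a decomposition $\langle\phi,\psi\rangle_P=\sum_{i=1}^\infty\langle\phi,p_i\rangle_{X,X^*}\langle\psi,p_i\rangle_{X,X^*}$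 ($\phi,\psi\in X$) of the value bilinear form. Furthermore, $v\in\mathrm{L}^\infty_{w^2}(\Omega)$.
   Context: For $z\in\bar\Omega$, $\Phi^t(z)$ denotes the value at time $t\ge 0$ of the solution of $\dot x=f(x)$, $x(0)=z$; the condition $\nu^\top f\le 0$ on $\partial\Omega$ guarantees that $\Phi^t(z)$ exists and stays in $\bar\Omega$ for all $t\ge0$. The weight $w$ is positive and finite almost everywhere; $\nabla w$ is understood almost everywhere, $\nabla w=-w^2\nabla(w^{-1})$. The weighted spaces are defined by the norms $\|\phi\|_{\mathrm{L}^p_w(\Omega)}=\big(\int_\Omega|\phi|^p w\,dx\big)^{1/p}$ for $1\le p<\infty$ and $\|\phi\|_{\mathrm{L}^\infty_w(\Omega)}=\operatorname{ess\,sup}_{x\in\Omega}|\phi(x)w(x)|$; thus $v\in\mathrm{L}^\infty_{w^2}(\Omega)$ means $\operatorname{ess\,sup}|v\,w^2|<\infty$. The dual of $X=\mathrm{L}^1_w(\Omega)$ is identified with $X^*=\mathrm{L}^\infty_w(\Omega)$ through $\langle\phi,\varphi\rangle_{X,X^*}=\int_\Omega\phi\varphi w^2\,dx$; $H=\mathrm{L}^2_{w^2}(\Omega)$, and $X^*\subset H\subset X$. The preadjoint $S(t)\in\mathcal{L}(X)$ satisfies $\langle S(t)\rho,\varphi\rangle_{X,X^*}=\langle\rho,S^*(t)\varphi\rangle_{X,X^*}$. "Exponentially stable over $X$ with rate $\omega_0$" means that there is $M\ge1$ with $\|S(t)\|_{\mathcal{L}(X)}\le Me^{\omega_0t}$ for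 all $t\ge0$, where $\omega_0<0$. The observation operator is $C:X\to\ell_2$, $C\phi=(\langle\phi,c_i\rangle_{X,X^*})_{i\in\mathbb{N}}$, and the value bilinear form is $\langle\phi,\psi\rangle_P=\int_0^\infty\langle CS(t)\phi,CS(t)\psi\rangle_{\ell_2}\,dt$ for $\phi,\psi\in X$. Under exponential stability over $X$, a decomposition of $\langle\cdot,\cdot\rangle_P$ as in the claim exists; $\sum_ip_i^2$ is called the sum of squares solution. *)

theory Defs
  imports "HOL-Analysis.Analysis" "HOL-Probability.Essential_Supremum"
begin

section \<open>Classical differentiability and domains with \<open>C\<^sup>1\<close> boundary\<close>

definition C1_on :: "'a::euclidean_space set \<Rightarrow> ('a \<Rightarrow> 'b::euclidean_space) \<Rightarrow> bool" where
  "C1_on S f \<longleftrightarrow>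
     (\<exists>f' :: 'a \<Rightarrow> 'a \<Rightarrow>\<^sub>L 'b.
        (\<forall>x\<in>S. (f has_derivative blinfun_apply (f' x)) (at x within S)) \<and> continuous_on S f')"

text \<open>
  Near \<open>x0\<close>, the set \<open>\<Omega>\<close> is the strict epigraph of a \<open>C\<^sup>1\<close> function in the
  unit direction \<open>e\<close>.  A function on the hyperplane orthogonal to \<open>e\<close> is represented by a
  function \<open>\<gamma>\<close> on the whole space that is constant along \<open>e\<close>; this avoids choosing
  coordinates in dimension \<open>d - 1\<close> and covers \<open>d = 1\<close>, where \<open>\<gamma>\<close> is constant.
\<close>
definition C1_graph_chart ::
    "(real^'n) set \<Rightarrow> real^'n \<Rightarrow> real \<Rightarrow> real^'n \<Rightarrow> (real^'n \<Rightarrow> real) \<Rightarrow> bool" where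
  "C1_graph_chart \<Omega> x0 r e \<gamma> \<longleftrightarrow>
     0 < r \<and> norm e = 1 \<and> C1_on UNIV \<gamma> \<and> (\<forall>x s. \<gamma> (x + s *\<^sub>R e) = \<gamma> x) \<and>
     \<Omega> \<inter> ball x0 r = {x \<in> ball x0 r. \<gamma> x < x \<bullet> e}"

definition C1_boundary :: "(real^'n) set \<Rightarrow> bool" where
  "C1_boundary \<Omega> \<longleftrightarrow> (\<forall>x0\<in>frontier \<Omega>. \<exists>r e \<gamma>. C1_graph_chart \<Omega> x0 r e \<gamma>)"

text \<open>
  In a chart, \<open>\<Omega>\<close> is locally the set where \<open>\<gamma> x - x \<bullet> e < 0\<close>, so the outer normal is
  the normalised gradient of this function.
\<close>
definition outer_unit_normal :: "(real^'n) set \<Rightarrow> real^'n \<Rightarrow> real^'n \<Rightarrow> bool" where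
  "outer_unit_normal \<Omega> x0 n \<longleftrightarrow>
     (\<exists>r e \<gamma> G. C1_graph_chart \<Omega> x0 r e \<gamma> \<and> GDERIV \<gamma> x0 :> G \<and> n = sgn (G - e))"


section \<open>Weighted Lebesgue spaces\<close>

text \<open>
  Elements are represented by measurable functions rather than by classes modulo null sets;
  accordingly, equality in these spaces is equality almost everywhere on \<open>\<Omega>\<close>.
\<close>
definition wLp :: "real \<Rightarrow> (real^'n) set \<Rightarrow> (real^'n \<Rightarrow> real) \<Rightarrow> (real^'n \<Rightarrow> real) set" where
  "wLp p \<Omega> w = {\<phi> \<in> borel_measurable (lebesgue_on \<Omega>).
                  integrable (lebesgue_on \<Omega>) (\<lambda>x. \<bar>\<phi> x\<bar> powr p * w x)}"

definition wLp_norm :: "real \<Rightarrow> (real^'n) set \<Rightarrow> (real^'n \<Rightarrow> real) \<Rightarrow> (real^'n \<Rightarrow> real) \<Rightarrow> real" where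
  "wLp_norm p \<Omega> w \<phi> = (LINT x|lebesgue_on \<Omega>. \<bar>\<phi> x\<bar> powr p * w x) powr (1 / p)"

definition wLinf :: "(real^'n) set \<Rightarrow> (real^'n \<Rightarrow> real) \<Rightarrow> (real^'n \<Rightarrow> real) set" where
  "wLinf \<Omega> w = {\<phi> \<in> borel_measurable (lebesgue_on \<Omega>).
                  esssup (lebesgue_on \<Omega>) (\<lambda>x. ereal \<bar>\<phi> x * w x\<bar>) < \<infinity>}"

definition wLinf_norm :: "(real^'n) set \<Rightarrow> (real^'n \<Rightarrow> real) \<Rightarrow> (real^'n \<Rightarrow> real) \<Rightarrow> real" where
  "wLinf_norm \<Omega> w \<phi> = real_of_ereal (esssup (lebesgue_on \<Omega>) (\<lambda>x. ereal \<bar>\<phi> x * w x\<bar>))"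

definition pairing ::
    "(real^'n) set \<Rightarrow> (real^'n \<Rightarrow> real) \<Rightarrow> (real^'n \<Rightarrow> real) \<Rightarrow> (real^'n \<Rightarrow> real) \<Rightarrow> real" where
  "pairing \<Omega> w \<phi> \<psi> = (LINT x|lebesgue_on \<Omega>. \<phi> x * \<psi> x * (w x)\<^sup>2)"


section \<open>Weak gradients and \<open>W\<^sup>1\<^sup>,\<^sup>\<infinity>\<close>\<close>

definition partial_deriv :: "'n \<Rightarrow> (real^'n \<Rightarrow> real) \<Rightarrow> real^'n \<Rightarrow> real" where
  "partial_deriv i \<phi> x = frechet_derivative \<phi> (at x) (axis i 1)"

text \<open>
  \<open>C\<^sup>\<infinity>\<close>: every iterated partial derivative, of any order, exists and is (totally)
  differentiable everywhere.
\<close>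
definition smooth :: "(real^'n \<Rightarrow> real) \<Rightarrow> bool" where
  "smooth \<phi> \<longleftrightarrow> (\<forall>is :: 'n list. \<forall>x. foldr partial_deriv is \<phi> differentiable (at x))"

definition test_functions :: "(real^'n) set \<Rightarrow> (real^'n \<Rightarrow> real) set" where
  "test_functions \<Omega> = {\<phi>. smooth \<phi> \<and> (\<exists>K. compact K \<and> K \<subseteq> \<Omega> \<and> (\<forall>x. x \<notin> K \<longrightarrow> \<phi> x = 0))}"

definition has_weak_gradient ::
    "(real^'n) set \<Rightarrow> (real^'n \<Rightarrow> real) \<Rightarrow> (real^'n \<Rightarrow> real^'n) \<Rightarrow> bool" where
  "has_weak_gradient \<Omega> u G \<longleftrightarrow>
     (\<forall>K. compact K \<longrightarrow> K \<subseteq> \<Omega> \<longrightarrow>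
        integrable (lebesgue_on K) u \<and> integrable (lebesgue_on K) G) \<and>
     (\<forall>\<phi>\<in>test_functions \<Omega>. \<forall>i.
        (LINT x|lebesgue_on \<Omega>. u x * partial_deriv i \<phi> x) = - (LINT x|lebesgue_on \<Omega>. G x $ i * \<phi> x))"

text \<open>Determined only up to a null set.\<close>
definition weak_gradient :: "(real^'n) set \<Rightarrow> (real^'n \<Rightarrow> real) \<Rightarrow> real^'n \<Rightarrow> real^'n" where
  "weak_gradient \<Omega> u = (SOME G. has_weak_gradient \<Omega> u G)"

definition W1inf :: "(real^'n) set \<Rightarrow> (real^'n \<Rightarrow> real) set" where
  "W1inf \<Omega> = {u \<in> wLinf \<Omega> (\<lambda>_. 1).
                \<exists>G. has_weak_gradient \<Omega> u G \<and> (\<forall>i. (\<lambda>x. G x $ i) \<in> wLinf \<Omega> (\<lambda>_. 1))}"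

text \<open>\<open>\<nabla>w\<close> is understood through the chain rule \<open>\<nabla>w = - w\<^sup>2 \<nabla>(1 / w)\<close>.\<close>
definition weight_gradient :: "(real^'n) set \<Rightarrow> (real^'n \<Rightarrow> real) \<Rightarrow> real^'n \<Rightarrow> real^'n" where
  "weight_gradient \<Omega> w x = - ((w x)\<^sup>2 *\<^sub>R weak_gradient \<Omega> (\<lambda>y. inverse (w y)) x)"


section \<open>Flow, composition semigroup and its preadjoint\<close>

definition is_flow_on ::
    "(real^'n \<Rightarrow> real^'n) \<Rightarrow> (real^'n) set \<Rightarrow> (real \<Rightarrow> real^'n \<Rightarrow> real^'n) \<Rightarrow> bool" where
  "is_flow_on f D \<Phi> \<longleftrightarrow>
     (\<forall>z\<in>D. \<Phi> 0 z = z \<and>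
        (\<forall>t\<ge>0. ((\<lambda>s. \<Phi> s z) has_vector_derivative f (\<Phi> t z)) (at t within {0..})))"

text \<open>Operator norm on \<open>X = L\<^sup>1\<^sub>w\<close>: the least bound, and \<open>\<infinity>\<close> if there is none.\<close>
definition X_opnorm ::
    "(real^'n) set \<Rightarrow> (real^'n \<Rightarrow> real) \<Rightarrow> ((real^'n \<Rightarrow> real) \<Rightarrow> (real^'n \<Rightarrow> real)) \<Rightarrow> ereal" where
  "X_opnorm \<Omega> w T =
     Inf {ereal K | K. 0 \<le> K \<and> (\<forall>\<rho>\<in>wLp 1 \<Omega> w. wLp_norm 1 \<Omega> w (T \<rho>) \<le> K * wLp_norm 1 \<Omega> w \<rho>)}"

text \<open>
  The space \<open>\<L>(X)\<close>. Linearity and boundedness make an operator on representatives respect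
  equality almost everywhere.
\<close>
definition X_bounded_ops ::
    "(real^'n) set \<Rightarrow> (real^'n \<Rightarrow> real) \<Rightarrow> ((real^'n \<Rightarrow> real) \<Rightarrow> (real^'n \<Rightarrow> real)) set" where
  "X_bounded_ops \<Omega> w = {T.
     (\<forall>\<rho>\<in>wLp 1 \<Omega> w. T \<rho> \<in> wLp 1 \<Omega> w) \<and>
     (\<forall>\<rho>\<in>wLp 1 \<Omega> w. \<forall>\<sigma>\<in>wLp 1 \<Omega> w. \<forall>a b.
        AE x in lebesgue_on \<Omega>. T (\<lambda>y. a * \<rho> y + b * \<sigma> y) x = a * T \<rho> x + b * T \<sigma> x) \<and>
     X_opnorm \<Omega> w T < \<infinity>}"

definition preadjoint_semigroup ::
    "(real^'n) set \<Rightarrow> (real^'n \<Rightarrow> real) \<Rightarrow> (real \<Rightarrow> real^'n \<Rightarrow> real^'n) \<Rightarrow>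
     (real \<Rightarrow> (real^'n \<Rightarrow> real) \<Rightarrow> (real^'n \<Rightarrow> real)) \<Rightarrow> bool" where
  "preadjoint_semigroup \<Omega> w \<Phi> S \<longleftrightarrow>
     (\<forall>t\<ge>0. S t \<in> X_bounded_ops \<Omega> w \<and>
        (\<forall>\<rho>\<in>wLp 1 \<Omega> w. \<forall>\<phi>\<in>wLinf \<Omega> w. pairing \<Omega> w (S t \<rho>) \<phi> = pairing \<Omega> w \<rho> (\<phi> \<circ> \<Phi> t)))"

definition X_exp_stable ::
    "(real^'n) set \<Rightarrow> (real^'n \<Rightarrow> real) \<Rightarrow> (real \<Rightarrow> (real^'n \<Rightarrow> real) \<Rightarrow> (real^'n \<Rightarrow> real)) \<Rightarrow>
     real \<Rightarrow> bool" where
  "X_exp_stable \<Omega> w S \<omega>0 \<longleftrightarrow>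
     (\<exists>M\<ge>1. \<forall>t\<ge>0. X_opnorm \<Omega> w (S t) \<le> ereal (M * exp (\<omega>0 * t)))"


section \<open>Costs, value bilinear form and sum of squares decompositions\<close>

definition nuclear_cost ::
    "(real^'n) set \<Rightarrow> (real^'n \<Rightarrow> real) \<Rightarrow> (nat \<Rightarrow> real^'n \<Rightarrow> real) \<Rightarrow> (real^'n \<Rightarrow> real) \<Rightarrow> bool" where
  "nuclear_cost \<Omega> w c g \<longleftrightarrow>
     (\<forall>i. c i \<in> wLinf \<Omega> w) \<and> summable (\<lambda>i. (wLinf_norm \<Omega> w (c i))\<^sup>2) \<and>
     (\<forall>x\<in>\<Omega>. (\<lambda>i. (c i x)\<^sup>2) sums g x)"

definition observation ::
    "(real^'n) set \<Rightarrow> (real^'n \<Rightarrow> real) \<Rightarrow> (nat \<Rightarrow> real^'n \<Rightarrow> real) \<Rightarrow> (real^'n \<Rightarrow> real) \<Rightarrow> nat \<Rightarrow> real" where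
  "observation \<Omega> w c \<phi> i = pairing \<Omega> w \<phi> (c i)"

definition value_form ::
    "(real^'n) set \<Rightarrow> (real^'n \<Rightarrow> real) \<Rightarrow> (nat \<Rightarrow> real^'n \<Rightarrow> real) \<Rightarrow>
     (real \<Rightarrow> (real^'n \<Rightarrow> real) \<Rightarrow> (real^'n \<Rightarrow> real)) \<Rightarrow>
     (real^'n \<Rightarrow> real) \<Rightarrow> (real^'n \<Rightarrow> real) \<Rightarrow> real" where
  "value_form \<Omega> w c S \<phi> \<psi> =
     (LINT t|lebesgue_on {0..}. (\<Sum>i. observation \<Omega> w c (S t \<phi>) i * observation \<Omega> w c (S t \<psi>) i))"

definition sos_decomposition ::
    "(real^'n) set \<Rightarrow> (real^'n \<Rightarrow> real) \<Rightarrow> (nat \<Rightarrow> real^'n \<Rightarrow> real) \<Rightarrow>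
     (real \<Rightarrow> (real^'n \<Rightarrow> real) \<Rightarrow> (real^'n \<Rightarrow> real)) \<Rightarrow> (nat \<Rightarrow> real^'n \<Rightarrow> real) \<Rightarrow> bool" where
  "sos_decomposition \<Omega> w c S p \<longleftrightarrow>
     (\<forall>i. p i \<in> wLinf \<Omega> w) \<and> summable (\<lambda>i. (wLp_norm 2 \<Omega> (\<lambda>x. (w x)\<^sup>2) (p i))\<^sup>2) \<and>
     (\<forall>\<phi>\<in>wLp 1 \<Omega> w. \<forall>\<psi>\<in>wLp 1 \<Omega> w.
        (\<lambda>i. pairing \<Omega> w \<phi> (p i) * pairing \<Omega> w \<psi> (p i)) sums value_form \<Omega> w c S \<phi> \<psi>)"

definition lyapunov_function ::
    "(real^'n \<Rightarrow> real) \<Rightarrow> (real \<Rightarrow> real^'n \<Rightarrow> real^'n) \<Rightarrow> real^'n \<Rightarrow> real" where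
  "lyapunov_function g \<Phi> z = (LINT t|lebesgue_on {0..}. g (\<Phi> t z))"

end

theory Submission
  imports Defs
begin

text \<open>
Multiplication by the weight turns every pairing into a plain integral: if \<open>h\<close> and \<open>k\<close> are
\<open>\<phi> w\<close> and \<open>\<psi> w\<close> on \<open>\<Omega>\<close> and zero outside, then the pairing of \<open>\<phi>\<close> and \<open>\<psi>\<close> is the
integral of \<open>h k\<close>. Elements of \<open>X\<close> become integrable functions and elements of \<open>X\<^sup>*\<close> become
essentially bounded ones.

The semigroup enters only through the duality between \<open>S t\<close> and composition with \<open>\<Phi> t\<close>, and
two choices of test function extract all that is needed. The indicator of a set that
meets \<open>\<Omega>\<close> in a null set, for instance of the complement of \<open>\<Omega>\<close>, shows that at any given time
almost every trajectory avoids null sets and lies in \<open>\<Omega>\<close> (\<open>flow_avoids_null_set\<close>). The function \<open>1 / w\<close> turns the bound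
on \<open>S t\<close> into the pointwise decay \<open>w z \<le> M e\<^bsup>\<omega> t\<^esup> w (\<Phi> t z)\<close> for almost every \<open>z\<close>
(\<open>flow_decay\<close>). Hence \<open>D\<^sub>i (t, z) = c\<^sub>i (\<Phi> t z) w z\<close> agrees almost everywhere with a Borel
function bounded by \<open>M e\<^bsup>\<omega> t\<^esup> \<parallel>c\<^sub>i\<parallel>\<close> (\<open>trajectory_kernel\<close>). Joint measurability of \<open>D\<^sub>i\<close> comes from
the joint continuity of the flow, a Gronwall argument (\<open>flow_continuous_on\<close>). The value form is
then the integral over \<open>t\<close> of \<open>\<Sum>\<^sub>i (\<integral> h z D\<^sub>i (t, z) dz) (\<integral> k z D\<^sub>i (t, z) dz)\<close>,
and \<open>v w\<^sup>2\<close> is the diagonal \<open>\<integral> \<Sum>\<^sub>i D\<^sub>i (t, z)\<^sup>2 dt\<close> of its kernel (\<open>lyapunov_gram_trace\<close>), which is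
bounded. So \<open>v\<close> exists and \<open>v w\<^sup>2\<close> is bounded.

Both statements about decompositions rest on Parseval's identity for a sequence \<open>e\<^sub>k\<close> in \<open>L\<^sup>2\<close>
(\<open>parseval_sequence_lborel\<close>), used once in time and once in space.
In time: the coefficients \<open>\<integral> D\<^sub>i (t, z) e\<^sub>k t dt\<close>, indexed by pairs \<open>(i, k)\<close>, decompose the value
form (\<open>decomposition_exists\<close>).
In space: the equality \<open>v = \<Sum>\<^sub>i p\<^sub>i\<^sup>2\<close> concerns the diagonal of a kernel, a null set of the
product space, so it cannot be read off from the kernel as an element of a Lebesgue space. It is a
trace identity: for every measurable \<open>E\<close>, expanding \<open>1\<^sub>E p\<^sub>i w\<close> along \<open>e\<^sub>k\<close> shows that the integral of
\<open>\<Sum>\<^sub>i p\<^sub>i\<^sup>2 w\<^sup>2\<close> over \<open>E\<close> is the sum over \<open>k\<close> of the value form at \<open>1\<^sub>E e\<^sub>k / w\<close>. This does not depend on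
the decomposition, and expanding \<open>D\<^sub>i (t, \<cdot>)\<close> in the same way gives the integral of \<open>v w\<^sup>2\<close> over \<open>E\<close>
(\<open>diagonal_unique\<close>).
\<close>


section \<open>Orthonormal expansions in square integrable functions\<close>

definition L2 :: "'a measure \<Rightarrow> ('a \<Rightarrow> real) set" where
  "L2 M = {f \<in> borel_measurable M. integrable M (\<lambda>x. (f x)\<^sup>2)}"

definition L2_inner :: "'a measure \<Rightarrow> ('a \<Rightarrow> real) \<Rightarrow> ('a \<Rightarrow> real) \<Rightarrow> real" where
  "L2_inner M f g = (LINT x|M. f x * g x)"

lemma L2_measurable: "f \<in> L2 M \<Longrightarrow> f \<in> borel_measurable M"
  by (simp add: L2_def)

lemma L2_mult_integrable:
  assumes "f \<in> L2 M" "g \<in> L2 M"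
  shows "integrable M (\<lambda>x. f x * g x)"
proof (rule Bochner_Integration.integrable_bound)
  show "integrable M (\<lambda>x. (f x)\<^sup>2 + (g x)\<^sup>2)" "(\<lambda>x. f x * g x) \<in> borel_measurable M"
    using assms by (auto simp: L2_def)
  have "\<bar>a * b\<bar> \<le> a\<^sup>2 + b\<^sup>2" for a b :: real
    using sum_squares_bound[of "\<bar>a\<bar>" "\<bar>b\<bar>"] abs_ge_zero[of "a * b"] unfolding abs_mult power2_abs
    by linarith
  then show "AE x in M. norm (f x * g x) \<le> norm ((f x)\<^sup>2 + (g x)\<^sup>2)"
    by simp
qed

lemma L2_dominated:
  assumes "f \<in> L2 M" "g \<in> borel_measurable M" "\<And>x. x \<in> space M \<Longrightarrow> \<bar>g x\<bar> \<le> \<bar>f x\<bar>"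
  shows "g \<in> L2 M"
  using assms unfolding L2_def
  by (auto intro!: Bochner_Integration.integrable_bound[of M "\<lambda>x. (f x)\<^sup>2"] AE_I2 simp: abs_le_square_iff)

lemma L2_zero: "(\<lambda>x. 0) \<in> L2 M"
  by (simp add: L2_def)

lemma L2_add:
  assumes "f \<in> L2 M" "g \<in> L2 M"
  shows "(\<lambda>x. f x + g x) \<in> L2 M"
proof -
  have "integrable M (\<lambda>x. (f x)\<^sup>2 + (g x)\<^sup>2 + 2 * (f x * g x))"
    using assms L2_mult_integrable[OF assms] by (auto simp: L2_def)
  then show ?thesis
    using assms by (auto simp: L2_def power2_sum mult.assoc)
qed

lemma L2_scale: "f \<in> L2 M \<Longrightarrow> (\<lambda>x. a * f x) \<in> L2 M"
  by (auto simp: L2_def power_mult_distrib)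

lemma L2_diff:
  assumes "f \<in> L2 M" "g \<in> L2 M"
  shows "(\<lambda>x. f x - g x) \<in> L2 M"
  using L2_add[OF assms(1) L2_scale[OF assms(2), of "-1"]] by simp

lemma L2_sum: "(\<And>k. k \<in> A \<Longrightarrow> f k \<in> L2 M) \<Longrightarrow> (\<lambda>x. \<Sum>k\<in>A. f k x) \<in> L2 M"
  by (induction A rule: infinite_finite_induct) (auto intro: L2_zero L2_add)

lemma L2_inner_sym: "L2_inner M f g = L2_inner M g f"
  by (simp add: L2_inner_def mult.commute)

lemma L2_inner_add:
  assumes "f \<in> L2 M" "g \<in> L2 M" "h \<in> L2 M"
  shows "L2_inner M (\<lambda>x. f x + g x) h = L2_inner M f h + L2_inner M g h"
  using assms by (simp add: L2_inner_def distrib_right L2_mult_integrable)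

lemma L2_inner_diff:
  assumes "f \<in> L2 M" "g \<in> L2 M" "h \<in> L2 M"
  shows "L2_inner M (\<lambda>x. f x - g x) h = L2_inner M f h - L2_inner M g h"
  using assms by (simp add: L2_inner_def left_diff_distrib L2_mult_integrable)

lemma L2_inner_scale: "L2_inner M (\<lambda>x. a * f x) g = a * L2_inner M f g"
  by (simp add: L2_inner_def mult.assoc)

lemma L2_inner_add_right:
  assumes "f \<in> L2 M" "g \<in> L2 M" "h \<in> L2 M"
  shows "L2_inner M h (\<lambda>x. f x + g x) = L2_inner M h f + L2_inner M h g"
  using assms by (simp add: L2_inner_def distrib_left L2_mult_integrable)

lemma L2_inner_diff_right:
  assumes "f \<in> L2 M" "g \<in> L2 M" "h \<in> L2 M"
  shows "L2_inner M h (\<lambda>x. f x - g x) = L2_inner M h f - L2_inner M h g"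
  using assms by (simp add: L2_inner_def right_diff_distrib L2_mult_integrable)

lemma L2_inner_scale_right: "L2_inner M g (\<lambda>x. a * f x) = a * L2_inner M g f"
  by (simp add: L2_inner_def mult.left_commute)

lemma L2_inner_zero_right: "L2_inner M g (\<lambda>x. 0) = 0"
  by (simp add: L2_inner_def)

lemma L2_inner_zero: "L2_inner M (\<lambda>x. 0) g = 0"
  by (simp add: L2_inner_def)

lemma L2_inner_sum:
  assumes "\<And>k. k \<in> A \<Longrightarrow> f k \<in> L2 M" "g \<in> L2 M"
  shows "L2_inner M (\<lambda>x. \<Sum>k\<in>A. f k x) g = (\<Sum>k\<in>A. L2_inner M (f k) g)"
  using assms
  by (induction A rule: infinite_finite_induct) (auto simp: L2_inner_zero L2_inner_add L2_sum)

lemma L2_inner_nonneg: "0 \<le> L2_inner M f f"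
  by (simp add: L2_inner_def)

text \<open>
A vector that already lies in the span of its predecessors is mapped to zero, since then the norm
in the denominator vanishes; the resulting sequence consists of zeros and orthonormal functions,
which is all that Parseval's identity needs.
\<close>
fun gram_schmidt :: "'a measure \<Rightarrow> (nat \<Rightarrow> 'a \<Rightarrow> real) \<Rightarrow> nat \<Rightarrow> 'a \<Rightarrow> real" where
  "gram_schmidt M h n =
     (let r = (\<lambda>x. h n x - (\<Sum>k<n. L2_inner M (h n) (gram_schmidt M h k) * gram_schmidt M h k x))
      in (\<lambda>x. inverse (sqrt (L2_inner M r r)) * r x))"

declare gram_schmidt.simps [simp del]

definition gs_residual :: "'a measure \<Rightarrow> (nat \<Rightarrow> 'a \<Rightarrow> real) \<Rightarrow> nat \<Rightarrow> ('a \<Rightarrow> real) \<Rightarrow> 'a \<Rightarrow> real" where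
  "gs_residual M h n f =
     (\<lambda>x. f x - (\<Sum>k<n. L2_inner M f (gram_schmidt M h k) * gram_schmidt M h k x))"

lemma gram_schmidt_eq:
  "gram_schmidt M h n =
     (\<lambda>x. inverse (sqrt (L2_inner M (gs_residual M h n (h n)) (gs_residual M h n (h n))))
            * gs_residual M h n (h n) x)"
  by (subst gram_schmidt.simps) (simp add: gs_residual_def Let_def)

definition parseval :: "'a measure \<Rightarrow> (nat \<Rightarrow> 'a \<Rightarrow> real) \<Rightarrow> ('a \<Rightarrow> real) \<Rightarrow> bool" where
  "parseval M h f \<longleftrightarrow> (\<lambda>k. (L2_inner M f (gram_schmidt M h k))\<^sup>2) sums L2_inner M f f"

context
  fixes M :: "'a measure" and h :: "nat \<Rightarrow> 'a \<Rightarrow> real"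
  assumes h: "\<And>n. h n \<in> L2 M"
begin

abbreviation (input) "gs \<equiv> gram_schmidt M h"

lemma gram_schmidt_L2: "gs n \<in> L2 M"
proof (induction n rule: less_induct)
  case (less n)
  then have "gs_residual M h n (h n) \<in> L2 M"
    unfolding gs_residual_def by (intro L2_diff h L2_sum L2_scale) auto
  then show ?case
    by (subst gram_schmidt_eq) (rule L2_scale)
qed

lemma gs_residual_L2: "f \<in> L2 M \<Longrightarrow> gs_residual M h n f \<in> L2 M"
  unfolding gs_residual_def by (intro L2_diff L2_sum L2_scale gram_schmidt_L2)

lemma gram_schmidt_zero_or_unit: "gs n = (\<lambda>x. 0) \<or> L2_inner M (gs n) (gs n) = 1"
proof (cases "L2_inner M (gs_residual M h n (h n)) (gs_residual M h n (h n)) = 0")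
  case True
  then show ?thesis by (subst gram_schmidt_eq) simp
next
  case False
  let ?r = "gs_residual M h n (h n)"
  have pos: "0 < L2_inner M ?r ?r"
    using False L2_inner_nonneg[of M ?r] by linarith
  have "L2_inner M (gs n) (gs n) =
      inverse (sqrt (L2_inner M ?r ?r)) * (inverse (sqrt (L2_inner M ?r ?r)) * L2_inner M ?r ?r)"
    by (simp only: gram_schmidt_eq[of M h n] L2_inner_scale L2_inner_scale_right)
  also have "\<dots> = 1"
    using pos by (simp add: field_simps)
  finally show ?thesis ..
qed

lemma sum_single_nonzero:
  fixes c X :: "nat \<Rightarrow> real"
  assumes "j < n" "\<And>k. k < n \<Longrightarrow> k \<noteq> j \<Longrightarrow> X k = 0"
  shows "(\<Sum>k<n. c k * X k) = c j * X j"
  using assms by (subst sum.mono_neutral_right[of "{..<n}" "{j}"]) auto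

lemma L2_inner_gs_residual:
  assumes "f \<in> L2 M" "g \<in> L2 M"
  shows "L2_inner M (gs_residual M h n f) g = L2_inner M f g - (\<Sum>k<n. L2_inner M f (gs k) * L2_inner M (gs k) g)"
  unfolding gs_residual_def using assms
  by (subst L2_inner_diff, simp, intro L2_sum L2_scale gram_schmidt_L2, simp)
     (subst L2_inner_sum, auto simp: L2_scale gram_schmidt_L2 L2_inner_scale)

lemma gram_schmidt_orthogonal: "j < n \<Longrightarrow> L2_inner M (gs n) (gs j) = 0"
proof (induction n arbitrary: j rule: less_induct)
  case (less n)
  have "L2_inner M (gs k) (gs j) = 0" if "k < n" "k \<noteq> j" for k
    using less.IH[of k j] less.IH[of j k] less.prems that
    by (cases k j rule: linorder_cases) (auto simp: L2_inner_sym[of M "gs k" "gs j"])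
  then have "L2_inner M (gs_residual M h n (h n)) (gs j)
      = L2_inner M (h n) (gs j) - L2_inner M (h n) (gs j) * L2_inner M (gs j) (gs j)"
    using less.prems by (subst L2_inner_gs_residual) (auto simp: h gram_schmidt_L2 sum_single_nonzero)
  also have "\<dots> = 0"
    using gram_schmidt_zero_or_unit[of j]
    by (auto simp: L2_inner_zero_right)
  finally show ?case
    by (simp only: gram_schmidt_eq[of M h n] L2_inner_scale mult_zero_right)
qed

text \<open>
The quadratic form on the left is the defect in Bessel's inequality. It is positive semidefinite
and bounded by the squared norm, so the functions on which it tends to zero form a closed subspace.
\<close>
lemma gs_residual_norm:
  assumes "f \<in> L2 M"
  shows "L2_inner M (gs_residual M h n f) (gs_residual M h n f) = L2_inner M f f - (\<Sum>k<n. (L2_inner M f (gs k))\<^sup>2)"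
proof -
  have orth: "L2_inner M (gs_residual M h n f) (gs j) = 0" if "j < n" for j
  proof -
    have "L2_inner M (gs k) (gs j) = 0" if "k \<noteq> j" for k
      using gram_schmidt_orthogonal[of k j] gram_schmidt_orthogonal[of j k] that
      by (cases k j rule: linorder_cases) (auto simp: L2_inner_sym[of M "gs k" "gs j"])
    then have "L2_inner M (gs_residual M h n f) (gs j)
        = L2_inner M f (gs j) - L2_inner M f (gs j) * L2_inner M (gs j) (gs j)"
      using that assms by (subst L2_inner_gs_residual) (auto simp: gram_schmidt_L2 sum_single_nonzero)
    also have "\<dots> = 0"
      using gram_schmidt_zero_or_unit[of j] by (auto simp: L2_inner_zero_right)
    finally show ?thesis .
  qed
  have "L2_inner M (gs_residual M h n f) (gs_residual M h n f)
      = L2_inner M f (gs_residual M h n f) - (\<Sum>k<n. L2_inner M f (gs k) * L2_inner M (gs k) (gs_residual M h n f))"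
    using assms by (intro L2_inner_gs_residual gs_residual_L2)
  also have "\<dots> = L2_inner M (gs_residual M h n f) f"
    by (subst sum.neutral) (auto simp: orth L2_inner_sym[of M "gs k" "gs_residual M h n f" for k]
        L2_inner_sym[of M f "gs_residual M h n f"])
  also have "\<dots> = L2_inner M f f - (\<Sum>k<n. L2_inner M f (gs k) * L2_inner M (gs k) f)"
    using assms by (intro L2_inner_gs_residual)
  finally show ?thesis
    by (simp add: power2_eq_square L2_inner_sym[of M "gs k" f for k])
qed

lemma gs_residual_norm_le:
  "f \<in> L2 M \<Longrightarrow> L2_inner M (gs_residual M h n f) (gs_residual M h n f) \<le> L2_inner M f f"
  by (simp add: gs_residual_norm sum_nonneg)

lemma gs_residual_add:
  assumes "f \<in> L2 M" "g \<in> L2 M"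
  shows "gs_residual M h n (\<lambda>x. f x + g x) = (\<lambda>x. gs_residual M h n f x + gs_residual M h n g x)"
  using assms
  by (auto simp: gs_residual_def L2_inner_add gram_schmidt_L2 distrib_right sum.distrib)

lemma parseval_iff:
  assumes "f \<in> L2 M"
  shows "parseval M h f \<longleftrightarrow> (\<lambda>n. L2_inner M (gs_residual M h n f) (gs_residual M h n f)) \<longlonglongrightarrow> 0"
proof -
  have "parseval M h f \<longleftrightarrow> (\<lambda>n. (\<Sum>k<n. (L2_inner M f (gs k))\<^sup>2)) \<longlonglongrightarrow> L2_inner M f f"
    by (simp add: parseval_def sums_def)
  also have "\<dots> \<longleftrightarrow> (\<lambda>n. L2_inner M f f - (\<Sum>k<n. (L2_inner M f (gs k))\<^sup>2)) \<longlonglongrightarrow> 0"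
  proof
    assume "(\<lambda>n. L2_inner M f f - (\<Sum>k<n. (L2_inner M f (gs k))\<^sup>2)) \<longlonglongrightarrow> 0"
    from tendsto_diff[OF tendsto_const[of "L2_inner M f f"] this]
    show "(\<lambda>n. (\<Sum>k<n. (L2_inner M f (gs k))\<^sup>2)) \<longlonglongrightarrow> L2_inner M f f"
      by simp
  qed (auto intro!: tendsto_eq_intros)
  finally show ?thesis
    using assms by (simp add: gs_residual_norm)
qed

lemma L2_norm_add_le:
  assumes "f \<in> L2 M" "g \<in> L2 M"
  shows "L2_inner M (\<lambda>x. f x + g x) (\<lambda>x. f x + g x) \<le> 2 * L2_inner M f f + 2 * L2_inner M g g"
proof -
  have "0 \<le> L2_inner M (\<lambda>x. f x - g x) (\<lambda>x. f x - g x)"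
    by (rule L2_inner_nonneg)
  then show ?thesis
    using assms
    by (simp add: L2_inner_add L2_inner_diff L2_inner_add_right L2_inner_diff_right L2_add L2_diff
        L2_inner_sym[of M g f])
qed

lemma parseval_add:
  assumes "f \<in> L2 M" "g \<in> L2 M" "parseval M h f" "parseval M h g"
  shows "parseval M h (\<lambda>x. f x + g x)"
proof -
  let ?d = "\<lambda>f n. L2_inner M (gs_residual M h n f) (gs_residual M h n f)"
  have "(\<lambda>n. 2 * ?d f n + 2 * ?d g n) \<longlonglongrightarrow> 0"
    using assms by (auto simp: parseval_iff intro!: tendsto_eq_intros)
  then have "?d (\<lambda>x. f x + g x) \<longlonglongrightarrow> 0"
    by (rule Lim_null_comparison[rotated])
       (simp add: gs_residual_add assms L2_inner_nonneg L2_norm_add_le gs_residual_L2)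
  then show ?thesis
    using assms by (simp add: parseval_iff L2_add)
qed

lemma parseval_scale: "parseval M h f \<Longrightarrow> parseval M h (\<lambda>x. a * f x)"
  unfolding parseval_def
  by (drule sums_mult[of _ _ "a\<^sup>2"])
     (simp add: L2_inner_scale L2_inner_scale_right power2_eq_square mult.assoc mult.left_commute)

lemma parseval_limit:
  assumes f: "f \<in> L2 M" and F: "\<And>i. F i \<in> L2 M" "\<And>i. parseval M h (F i)"
    and lim: "(\<lambda>i. L2_inner M (\<lambda>x. f x - F i x) (\<lambda>x. f x - F i x)) \<longlonglongrightarrow> 0"
  shows "parseval M h f"
proof -
  let ?d = "\<lambda>f n. L2_inner M (gs_residual M h n f) (gs_residual M h n f)"
  have "(\<lambda>n. ?d f n) \<longlonglongrightarrow> 0"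
  proof (rule LIMSEQ_I)
    fix r :: real assume "0 < r"
    then obtain i where "\<forall>j\<ge>i. norm (L2_inner M (\<lambda>x. f x - F j x) (\<lambda>x. f x - F j x) - 0) < r / 4"
      using LIMSEQ_D[OF lim, of "r / 4"] by auto
    then have i: "L2_inner M (\<lambda>x. f x - F i x) (\<lambda>x. f x - F i x) < r / 4"
      by (auto simp: abs_less_iff)
    obtain N where "\<forall>n\<ge>N. norm (?d (F i) n - 0) < r / 4"
      using LIMSEQ_D[OF F(2)[of i, unfolded parseval_iff[OF F(1)]], of "r / 4"] \<open>0 < r\<close>
      by auto
    then have N: "?d (F i) n < r / 4" if "n \<ge> N" for n
      using that by (auto simp: abs_less_iff)
    show "\<exists>N. \<forall>n\<ge>N. norm (?d f n - 0) < r"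
    proof (intro exI[of _ N] allI impI)
      fix n assume "N \<le> n"
      have "?d f n = ?d (\<lambda>x. (f x - F i x) + F i x) n"
        by simp
      also have "\<dots> \<le> 2 * ?d (\<lambda>x. f x - F i x) n + 2 * ?d (F i) n"
        using f F by (subst (1 2) gs_residual_add) (auto intro!: L2_norm_add_le gs_residual_L2 L2_diff)
      also have "\<dots> < r"
        using gs_residual_norm_le[OF L2_diff[OF f F(1)], of n i] i N[OF \<open>N \<le> n\<close>] by linarith
      finally show "norm (?d f n - 0) < r"
        by (simp add: L2_inner_nonneg)
    qed
  qed
  then show ?thesis
    using f by (simp add: parseval_iff)
qed

text \<open>
The residual of \<open>h n\<close> after \<open>n\<close> steps is a multiple of the next vector, so nothing remains after
\<open>n + 1\<close> steps.
\<close>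
lemma parseval_gram_schmidt_input: "parseval M h (h n)"
proof -
  let ?r = "gs_residual M h n (h n)"
  have r: "?r \<in> L2 M" by (intro gs_residual_L2 h)
  have "L2_inner M ?r (gs n) = L2_inner M (h n) (gs n)"
    by (subst L2_inner_gs_residual)
       (auto simp: h gram_schmidt_L2 gram_schmidt_orthogonal L2_inner_sym[of M "gs k" "gs n" for k])
  moreover have "L2_inner M ?r (gs n) = inverse (sqrt (L2_inner M ?r ?r)) * L2_inner M ?r ?r"
    by (subst gram_schmidt_eq) (simp only: L2_inner_scale_right)
  moreover have "(inverse (sqrt q) * q)\<^sup>2 = q" if "0 \<le> q" for q :: real
    using that by (cases "q = 0") (simp_all add: power_mult_distrib power_inverse, simp add: power2_eq_square)
  ultimately have "(L2_inner M (h n) (gs n))\<^sup>2 = L2_inner M ?r ?r"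
    using L2_inner_nonneg[of M ?r] by metis
  then have eq: "(\<Sum>k<Suc n. (L2_inner M (h n) (gs k))\<^sup>2) = L2_inner M (h n) (h n)"
    by (simp add: gs_residual_norm h)
  have zero: "L2_inner M (gs_residual M h m (h n)) (gs_residual M h m (h n)) = 0" if "Suc n \<le> m" for m
  proof -
    have "(\<Sum>k<Suc n. (L2_inner M (h n) (gs k))\<^sup>2) \<le> (\<Sum>k<m. (L2_inner M (h n) (gs k))\<^sup>2)"
      using that by (intro sum_mono2) auto
    then show ?thesis
      using L2_inner_nonneg[of M "gs_residual M h m (h n)"] eq by (simp add: gs_residual_norm h)
  qed
  show ?thesis
    unfolding parseval_iff[OF h]
    by (rule tendsto_eventually) (auto simp: eventually_sequentially intro!: exI[of _ "Suc n"] zero)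
qed

end

lemma L2_limit_dominated:
  assumes f: "f \<in> L2 M" and F: "\<And>i. F i \<in> borel_measurable M"
    and lim: "\<And>x. x \<in> space M \<Longrightarrow> (\<lambda>i. F i x) \<longlonglongrightarrow> f x"
    and dom: "\<And>i x. x \<in> space M \<Longrightarrow> \<bar>f x - F i x\<bar> \<le> \<bar>f x\<bar>"
  shows "(\<lambda>i. L2_inner M (\<lambda>x. f x - F i x) (\<lambda>x. f x - F i x)) \<longlonglongrightarrow> 0"
proof -
  have [measurable]: "f \<in> borel_measurable M" "\<And>i. F i \<in> borel_measurable M"
    using f F by (auto simp: L2_def)
  have "(\<lambda>i. LINT x|M. (f x - F i x) * (f x - F i x)) \<longlonglongrightarrow> (LINT x|M. 0)"
  proof (rule integral_dominated_convergence[where w="\<lambda>x. (f x)\<^sup>2"])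
    show "AE x in M. (\<lambda>i. (f x - F i x) * (f x - F i x)) \<longlonglongrightarrow> 0"
      using lim by (intro AE_I2 tendsto_eq_intros) auto
    show "AE x in M. norm ((f x - F i x) * (f x - F i x)) \<le> (f x)\<^sup>2" for i
      using dom by (intro AE_I2) (auto simp: power2_eq_square[symmetric] abs_le_square_iff)
  qed (use f in \<open>auto simp: L2_def\<close>)
  then show ?thesis
    by (simp add: L2_inner_def)
qed

lemma (in finite_measure) indicator_L2: "A \<in> sets M \<Longrightarrow> indicator A \<in> L2 M"
  by (simp add: L2_def power2_eq_square indicator_inter_arith[symmetric]
      integrable_indicator_iff emeasure_eq_measure)

text \<open>
Orthonormalise the indicators of a countable generator. The functions that satisfy Parseval's
identity form a closed subspace: it contains the indicators of all measurable sets by Dynkin's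
argument, and then all square integrable functions by monotone approximation.
\<close>
lemma (in finite_measure) parseval_sequence_exists_finite:
  assumes G: "countable G" "Int_stable G" "G \<subseteq> Pow (space M)" "sets M = sigma_sets (space M) G"
    and sp: "space M \<in> G"
  shows "\<exists>e::nat \<Rightarrow> 'a \<Rightarrow> real. (\<forall>k. e k \<in> L2 M) \<and>
           (\<forall>f\<in>L2 M. (\<lambda>k. (L2_inner M f (e k))\<^sup>2) sums L2_inner M f f)"
proof -
  define h :: "nat \<Rightarrow> 'a \<Rightarrow> real" where "h n = indicator (from_nat_into G n)" for n
  have ne: "G \<noteq> {}" using sp by auto
  have GM: "G \<subseteq> sets M" using G(4) by auto
  have h: "h n \<in> L2 M" for n
    using from_nat_into[OF ne, of n] GM by (auto simp: h_def intro!: indicator_L2)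
  note P = parseval_add[of h M, OF h] parseval_scale[of h M, OF h] parseval_limit[of h M, OF h]
    parseval_gram_schmidt_input[of h M, OF h]
  let ?P = "parseval M h"
  have P_basic: "?P (indicator A)" if "A \<in> G" for A
    using P(4)[of "to_nat_on G A"] that G(1) by (simp add: h_def)
  have P_diff: "?P (\<lambda>x. f x - g x)" if "f \<in> L2 M" "g \<in> L2 M" "?P f" "?P g" for f g
    using P(1)[OF that(1) L2_scale[OF that(2)] that(3) P(2)[OF that(4)], of "-1"] by simp
  have P_ind: "?P (indicator A)" if "A \<in> sets M" for A
    using G(2,3) that[unfolded G(4)]
  proof (induction A rule: sigma_sets_induct_disjoint)
    case empty
    then show ?case using P(2)[OF P_basic[OF sp], of 0] by (simp add: indicator_def)
  next
    case (compl A)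
    then have "A \<in> sets M" by (simp add: G(4))
    then have "?P (\<lambda>x. indicator (space M) x - indicator A x)"
      by (intro P_diff[OF indicator_L2 indicator_L2 P_basic[OF sp] compl(2)]) auto
    moreover have "(\<lambda>x. indicator (space M) x - indicator A x) = (indicator (space M - A) :: 'a \<Rightarrow> real)"
      using sets.sets_into_space[OF \<open>A \<in> sets M\<close>] by (auto simp: indicator_def fun_eq_iff)
    ultimately show ?case by simp
  next
    case (union A)
    then have [measurable]: "A i \<in> sets M" for i by (auto simp: G(4))
    define F :: "nat \<Rightarrow> 'a \<Rightarrow> real" where "F n x = (\<Sum>i<n. indicator (A i) x)" for n x
    have F_eq: "F n = indicator (\<Union>i<n. A i)" for n
      unfolding F_def using union(1)
      by (intro ext) (simp add: indicator_UN_disjoint disjoint_family_on_def)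
    have F_P: "F n \<in> L2 M \<and> ?P (F n)" for n
    proof (induction n)
      case 0
      then show ?case
        using P(2)[OF P_basic[OF sp], of 0] by (simp add: F_def[abs_def] L2_zero)
    next
      case (Suc n)
      then show ?case
        using P(1)[of "F n" "indicator (A n)"] union(3) indicator_L2[of "A n"]
        by (auto simp: F_def[abs_def] intro!: L2_add)
    qed
    show ?case
    proof (rule P(3))
      show "(\<lambda>i. L2_inner M (\<lambda>x. indicator (\<Union>(range A)) x - F i x) (\<lambda>x. indicator (\<Union>(range A)) x - F i x)) \<longlonglongrightarrow> 0"
      proof (rule L2_limit_dominated)
        show "(\<lambda>i. F i x) \<longlonglongrightarrow> indicator (\<Union>(range A)) x" for x
          unfolding F_eq by (rule LIMSEQ_indicator_UN)
        show "\<bar>indicator (\<Union>(range A)) x - F i x\<bar> \<le> \<bar>indicator (\<Union>(range A)) x :: real\<bar>" for i x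
          unfolding F_eq by (auto simp: indicator_def)
      qed (use F_P in \<open>auto intro!: indicator_L2 L2_measurable\<close>)
    qed (use F_P in \<open>auto intro!: indicator_L2\<close>)
  qed (auto intro: P_basic)
  have P_pos: "u \<in> L2 M \<longrightarrow> ?P u" if "u \<in> borel_measurable M" "\<And>x. 0 \<le> u x" for u
    using that
  proof (induction u rule: borel_measurable_induct_real)
    case (set A)
    then show ?case by (simp add: P_ind)
  next
    case (mult u c)
    show ?case
    proof (cases "c = 0")
      case False
      then have "(\<lambda>x. c * u x) \<in> L2 M \<Longrightarrow> u \<in> L2 M"
        using L2_scale[of "\<lambda>x. c * u x" M "1 / c"] by simp
      then show ?thesis using mult.IH P(2) by blast
    qed (use P(2)[OF P_basic[OF sp], of 0] in simp)
  next
    case (add u v)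
    show ?case
    proof
      assume prem: "(\<lambda>x. v x + u x) \<in> L2 M"
      have "\<bar>u x\<bar> \<le> \<bar>v x + u x\<bar>" "\<bar>v x\<bar> \<le> \<bar>v x + u x\<bar>" for x
        using add.hyps(2)[of x] add.hyps(4)[of x] by auto
      then have L2: "u \<in> L2 M" "v \<in> L2 M"
        by - (rule L2_dominated[OF prem add.hyps(1)], simp, rule L2_dominated[OF prem add.hyps(3)], simp)
      show "?P (\<lambda>x. v x + u x)"
        using add.IH L2 by (intro P(1)) simp_all
    qed
  next
    case (seq U)
    show ?case
    proof
      assume prem: "u \<in> L2 M"
      have le: "0 \<le> U i x" "U i x \<le> u x" if "x \<in> space M" for i x
        using seq.hyps(3,4) that by (auto simp: seq.hyps(2) incseq_def le_fun_def intro!: incseq_le)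
      have U: "U i \<in> L2 M" for i
      proof (rule L2_dominated[OF prem seq.hyps(1)])
        fix x assume "x \<in> space M"
        then show "\<bar>U i x\<bar> \<le> \<bar>u x\<bar>" using le[of x i] by simp
      qed
      show "?P u"
      proof (rule P(3))
        show "(\<lambda>i. L2_inner M (\<lambda>x. u x - U i x) (\<lambda>x. u x - U i x)) \<longlonglongrightarrow> 0"
        proof (rule L2_limit_dominated[OF prem seq.hyps(1) seq.hyps(4)])
          show "\<bar>u x - U i x\<bar> \<le> \<bar>u x\<bar>" if "x \<in> space M" for i x
            using le[OF that, of i] by simp
        qed
        show "?P (U i)" for i
          using seq.IH U by simp
      qed (rule prem U)+
    qed
  qed
  have "?P f" if f: "f \<in> L2 M" for f
  proof -
    have [measurable]: "f \<in> borel_measurable M" and int: "integrable M (\<lambda>x. (f x)\<^sup>2)"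
      using f by (auto simp: L2_def)
    have *: "(\<lambda>x. max 0 (s * f x)) \<in> L2 M" if "\<bar>s\<bar> = 1" for s
    proof (rule L2_dominated[OF f])
      have "s = 1 \<or> s = -1" using that by linarith
      then show "\<bar>max 0 (s * f x)\<bar> \<le> \<bar>f x\<bar>" for x by auto
    qed simp
    have "?P (\<lambda>x. max 0 (1 * f x) - max 0 (-1 * f x))"
      using *[of 1] *[of "-1"] by (intro P_diff P_pos[rule_format]) auto
    moreover have "(\<lambda>x. max 0 (1 * f x) - max 0 (-1 * f x)) = f"
      by (auto simp: max_def)
    ultimately show ?thesis by simp
  qed
  then show ?thesis
    using gram_schmidt_L2[of h M, OF h] unfolding parseval_def by blast
qed


text \<open>
A \<open>\<sigma>\<close>-finite measure has a strictly positive integrable density, so the claim is transported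
from a finite measure.
\<close>
theorem (in sigma_finite_measure) parseval_sequence_exists:
  assumes G: "countable G" "Int_stable G" "G \<subseteq> Pow (space M)" "sets M = sigma_sets (space M) G"
    and sp: "space M \<in> G"
  shows "\<exists>e::nat \<Rightarrow> 'a \<Rightarrow> real. (\<forall>k. e k \<in> L2 M) \<and>
           (\<forall>f\<in>L2 M. (\<lambda>k. (L2_inner M f (e k))\<^sup>2) sums L2_inner M f f)"
proof -
  obtain H where H: "H \<in> borel_measurable M" "integral\<^sup>N M H \<noteq> \<infinity>"
    "\<And>x. x \<in> space M \<Longrightarrow> 0 < H x \<and> H x < \<infinity>"
    using Ex_finite_integrable_function by blast
  define d where "d x = enn2real (H x)" for x
  have d_meas [measurable]: "d \<in> borel_measurable M"
    using H(1) unfolding d_def[abs_def] by measurable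
  have d_pos: "0 < d x" if "x \<in> space M" for x
    using H(3)[OF that] by (simp add: d_def enn2real_positive_iff)
  have d_nonneg: "0 \<le> d x" for x by (simp add: d_def)
  have "integral\<^sup>N M (\<lambda>x. ennreal (d x)) = integral\<^sup>N M H"
    using H(3) by (intro nn_integral_cong) (auto simp: d_def less_top)
  then interpret N: finite_measure "density M d"
    using H(2) by (intro finite_measureI) (simp add: emeasure_density cong: nn_integral_cong)
  obtain e where e: "\<And>k. e k \<in> L2 (density M d)"
    and P: "\<And>f. f \<in> L2 (density M d) \<Longrightarrow>
        (\<lambda>k. (L2_inner (density M d) f (e k))\<^sup>2) sums L2_inner (density M d) f f"
    using N.parseval_sequence_exists_finite[of G] G sp unfolding sets_density space_density by metis
  have [measurable]: "e k \<in> borel_measurable M" for k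
    using e[of k] by (simp add: L2_def)
  \<comment> \<open>Multiplication by the square root of the density maps one space isometrically onto the other.\<close>
  define e' where "e' k x = sqrt (d x) * e k x" for k x
  have e'_L2: "e' k \<in> L2 M" for k
    using e[of k] unfolding e'_def L2_def
    by (auto simp: integrable_density d_nonneg power_mult_distrib)
  have "(\<lambda>k. (L2_inner M f (e' k))\<^sup>2) sums L2_inner M f f" if f: "f \<in> L2 M" for f
  proof -
    have [measurable]: "f \<in> borel_measurable M" using f by (simp add: L2_def)
    define f' where "f' x = f x / sqrt (d x)" for x
    have [measurable]: "f' \<in> borel_measurable M" by (simp add: f'_def[abs_def])
    have sq: "d x * (f' x * f' x) = f x * f x" if "x \<in> space M" for x
      using d_pos[OF that] by (simp add: f'_def field_simps)
    have mix: "d x * (f' x * e k x) = f x * e' k x" if "x \<in> space M" for x k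
      using d_pos[OF that] by (simp add: f'_def e'_def field_simps)
    have "integrable M (\<lambda>x. d x * (f' x * f' x))"
      using f unfolding L2_def by (auto simp: sq power2_eq_square cong: Bochner_Integration.integrable_cong)
    then have "f' \<in> L2 (density M d)"
      by (auto simp: L2_def integrable_density d_nonneg power2_eq_square)
    from P[OF this] show ?thesis
      by (simp add: L2_inner_def integral_density d_nonneg sq mix cong: Bochner_Integration.integral_cong)
  qed
  with e'_L2 show ?thesis by blast
qed

text \<open>
Finite intersections of a countable basis of the topology form a countable intersection-stable
generator that contains the whole space as the empty intersection.
\<close>
theorem parseval_sequence_lborel:
  obtains e :: "nat \<Rightarrow> 'a::euclidean_space \<Rightarrow> real"
  where "\<And>k. e k \<in> L2 lborel"
    and "\<And>f. f \<in> L2 lborel \<Longrightarrow> (\<lambda>k. (L2_inner lborel f (e k))\<^sup>2) sums L2_inner lborel f f"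
proof -
  obtain B :: "'a set set" where B: "countable B" "topological_basis B"
    using ex_countable_basis by blast
  define G where "G = (\<lambda>F. \<Inter>F) ` {F. finite F \<and> F \<subseteq> B}"
  have SB: "sigma_sets UNIV B = sets borel"
    using arg_cong[OF borel_eq_countable_basis[OF B], of sets] by simp
  have "sigma_sets UNIV B = sigma_sets UNIV G"
  proof (rule antisym)
    show "sigma_sets UNIV B \<subseteq> sigma_sets UNIV G"
      by (intro sigma_sets_mono') (auto simp: G_def intro!: image_eqI[where x="{b}" for b])
    have "\<Inter>F \<in> sigma_sets UNIV B" if "finite F" "F \<subseteq> B" for F
      using that
    proof (induction F)
      case (insert b F)
      then have "b \<in> sigma_sets UNIV B" "\<Inter>F \<in> sigma_sets UNIV B"
        by auto
      then show ?case by (simp add: SB sets.Int)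
    qed (auto intro: sigma_sets_top)
    then show "sigma_sets UNIV G \<subseteq> sigma_sets UNIV B"
      by (intro sigma_sets_mono) (auto simp: G_def)
  qed
  then have sets: "sets lborel = sigma_sets (space lborel) G"
    using SB by simp
  have stable: "Int_stable G"
  proof (rule Int_stableI)
    fix a b assume "a \<in> G" "b \<in> G"
    then obtain F F' where F: "finite F" "F \<subseteq> B" "a = \<Inter>F" "finite F'" "F' \<subseteq> B" "b = \<Inter>F'"
      by (auto simp: G_def)
    then have "a \<inter> b = \<Inter>(F \<union> F')" by auto
    then show "a \<inter> b \<in> G"
      unfolding G_def using F by (intro image_eqI[where x="F \<union> F'"]) auto
  qed
  have count: "countable G"
    unfolding G_def using B(1) by (intro countable_image countable_Collect_finite_subset)
  have top: "space lborel \<in> G"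
    unfolding G_def by (intro image_eqI[where x="{}"]) auto
  have "G \<subseteq> Pow (space lborel)" by simp
  from lborel.parseval_sequence_exists[OF count stable this sets top]
  obtain e :: "nat \<Rightarrow> 'a \<Rightarrow> real" where e: "\<forall>k. e k \<in> L2 lborel"
    "\<forall>f\<in>L2 lborel. (\<lambda>k. (L2_inner lborel f (e k))\<^sup>2) sums L2_inner lborel f f"
    by blast
  show ?thesis
    by (rule that[OF e(1)[rule_format] e(2)[rule_format]])
qed

section \<open>Continuity of the flow in time and initial value\<close>

lemma C1_on_lipschitz_on_ball:
  fixes f :: "'a::euclidean_space \<Rightarrow> 'b::euclidean_space"
  assumes "C1_on UNIV f"
  obtains L where "0 \<le> L"
    "\<And>x y. x \<in> cball 0 R \<Longrightarrow> y \<in> cball 0 R \<Longrightarrow> norm (f x - f y) \<le> L * norm (x - y)"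
proof -
  obtain f' :: "'a \<Rightarrow> 'a \<Rightarrow>\<^sub>L 'b" where f': "\<And>x. (f has_derivative blinfun_apply (f' x)) (at x)"
    "continuous_on UNIV f'"
    using assms by (auto simp: C1_on_def)
  have "compact (f' ` cball 0 R)"
    by (intro compact_continuous_image continuous_on_subset[OF f'(2)]) auto
  then obtain L where L: "\<forall>x\<in>cball 0 R. norm (f' x) \<le> L"
    by (auto dest!: compact_imp_bounded simp: bounded_iff)
  have lip: "norm (f x - f y) \<le> max 0 L * norm (x - y)" if "x \<in> cball 0 R" "y \<in> cball 0 R" for x y
  proof (rule differentiable_bound[OF convex_cball _ _ that])
    show "(f has_derivative blinfun_apply (f' z)) (at z within cball 0 R)" for z
      by (rule has_derivative_at_withinI[OF f'(1)])
    show "onorm (blinfun_apply (f' z)) \<le> max 0 L" if "z \<in> cball 0 R" for z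
      using bspec[OF L that] by (simp add: norm_blinfun.rep_eq[symmetric])
  qed
  show ?thesis
    by (rule that[OF max.cobounded1 lip])
qed

lemma gronwall_trajectories:
  fixes X Y :: "real \<Rightarrow> 'a::euclidean_space"
  assumes X: "\<And>t. 0 \<le> t \<Longrightarrow> (X has_vector_derivative f (X t)) (at t within {0..})"
    and Y: "\<And>t. 0 \<le> t \<Longrightarrow> (Y has_vector_derivative f (Y t)) (at t within {0..})"
    and lip: "\<And>s. 0 \<le> s \<Longrightarrow> s \<le> T \<Longrightarrow> norm (f (X s) - f (Y s)) \<le> L * norm (X s - Y s)"
    and T: "0 \<le> T"
  shows "norm (X T - Y T) \<le> exp (L * T) * norm (X 0 - Y 0)"
proof (cases "T = 0")
  case False
  then have "0 < T" using T by simp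
  \<comment> \<open>The squared distance, discounted at twice the Lipschitz rate, is nonincreasing.\<close>
  let ?u = "\<lambda>s. exp (- 2 * L * s) * ((X s - Y s) \<bullet> (X s - Y s))"
  have cont: "continuous_on {0..} X" "continuous_on {0..} Y"
    by (auto simp: continuous_on_eq_continuous_within intro: has_vector_derivative_continuous[OF X]
        has_vector_derivative_continuous[OF Y])
  have "?u T \<le> ?u 0"
  proof (rule DERIV_nonpos_imp_decreasing_open[OF T])
    show "continuous_on {0..T} ?u"
      using cont by (auto intro!: continuous_intros elim: continuous_on_subset)
    fix s assume s: "0 < s" "s < T"
    have at: "at s within {0..} = at s"
      using s by (intro at_within_interior) auto
    define D where "D = X s - Y s"
    define E where "E = f (X s) - f (Y s)"
    have D: "((\<lambda>s. X s - Y s) has_vector_derivative E) (at s)"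
      using has_vector_derivative_diff[OF X Y, of s] s by (simp add: at E_def)
    have "((\<lambda>s. (X s - Y s) \<bullet> (X s - Y s)) has_real_derivative 2 * (D \<bullet> E)) (at s)"
    proof -
      have "((\<lambda>s. (X s - Y s) \<bullet> (X s - Y s)) has_derivative (\<lambda>h. D \<bullet> (h *\<^sub>R E) + (h *\<^sub>R E) \<bullet> D)) (at s)"
        unfolding D_def
        by (rule has_derivative_inner[OF D[unfolded has_vector_derivative_def] D[unfolded has_vector_derivative_def]])
      also have "(\<lambda>h. D \<bullet> (h *\<^sub>R E) + (h *\<^sub>R E) \<bullet> D) = (*) (2 * (D \<bullet> E))"
        by (auto simp: fun_eq_iff inner_commute[of E D])
      finally show ?thesis
        by (simp only: has_field_derivative_def)
    qed
    then have "(?u has_real_derivative exp (- 2 * L * s) * (2 * (D \<bullet> E)) + (exp (- 2 * L * s) * (- 2 * L)) * (D \<bullet> D)) (at s)"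
      unfolding D_def by (auto intro!: derivative_eq_intros)
    moreover have "D \<bullet> E \<le> L * (D \<bullet> D)"
    proof -
      have "D \<bullet> E \<le> norm D * norm E" by (rule norm_cauchy_schwarz)
      also have "\<dots> \<le> norm D * (L * norm D)"
        using lip[of s] s by (intro mult_left_mono) (auto simp: D_def E_def)
      finally show ?thesis by (simp add: power2_norm_eq_inner[symmetric] power2_eq_square ac_simps)
    qed
    then have "exp (- 2 * L * s) * (2 * (D \<bullet> E - L * (D \<bullet> D))) \<le> 0"
      by (intro mult_nonneg_nonpos) auto
    ultimately show "\<exists>y. (?u has_real_derivative y) (at s) \<and> y \<le> 0"
      by (intro exI conjI) (auto simp: algebra_simps)
  qed
  then have "(norm (X T - Y T))\<^sup>2 \<le> (exp (L * T) * norm (X 0 - Y 0))\<^sup>2"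
    by (simp add: power2_norm_eq_inner exp_minus field_simps power_mult_distrib exp_double[symmetric])
  then show ?thesis
    by (rule power2_le_imp_le) simp
qed simp

text \<open>
Since trajectories may leave \<open>D\<close>, there is no global Lipschitz constant to start from. Around a
fixed trajectory on \<open>[0, T]\<close> the field is Lipschitz on the tube of radius one, and a neighbouring
trajectory that starts close enough cannot leave the tube: at its first exit time Gronwall's
inequality would still keep it strictly inside.
\<close>
lemma flow_continuous_on:
  fixes f :: "real^'n \<Rightarrow> real^'n"
  assumes C1: "C1_on UNIV f" and flow: "is_flow_on f D \<Phi>"
  shows "continuous_on ({0..} \<times> D) (\<lambda>(t, z). \<Phi> t z)"
proof -
  have zero: "\<Phi> 0 z = z" if "z \<in> D" for z
    using flow that by (simp add: is_flow_on_def)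
  have der: "((\<lambda>s. \<Phi> s z) has_vector_derivative f (\<Phi> t z)) (at t within {0..})" if "z \<in> D" "0 \<le> t" for t z
    using flow that by (simp add: is_flow_on_def)
  have cont: "continuous_on {0..} (\<lambda>s. \<Phi> s z)" if "z \<in> D" for z
    by (auto simp: continuous_on_eq_continuous_within intro: has_vector_derivative_continuous[OF der[OF that]])
  have near: "\<exists>\<delta>>0. \<exists>K>0. \<forall>z\<in>D. dist z z0 < \<delta> \<longrightarrow> (\<forall>t\<in>{0..T}. dist (\<Phi> t z) (\<Phi> t z0) \<le> K * dist z z0)"
    if z0: "z0 \<in> D" and T: "0 \<le> T" for z0 T
  proof -
    have "compact ((\<lambda>s. \<Phi> s z0) ` {0..T})"
      by (intro compact_continuous_image continuous_on_subset[OF cont[OF z0]]) auto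
    then obtain R where R: "\<forall>s\<in>{0..T}. norm (\<Phi> s z0) \<le> R"
      by (auto dest!: compact_imp_bounded simp: bounded_iff)
    obtain L where L: "0 \<le> L"
      "\<And>x y. x \<in> cball 0 (R + 1) \<Longrightarrow> y \<in> cball 0 (R + 1) \<Longrightarrow> norm (f x - f y) \<le> L * norm (x - y)"
      using C1_on_lipschitz_on_ball[OF C1] by blast
    have gron: "norm (\<Phi> t z - \<Phi> t z0) \<le> exp (L * t) * norm (z - z0)"
      if "z \<in> D" "t \<in> {0..T}" "\<And>s. 0 \<le> s \<Longrightarrow> s \<le> t \<Longrightarrow> norm (\<Phi> s z - \<Phi> s z0) \<le> 1" for z t
    proof -
      have "norm (\<Phi> t z - \<Phi> t z0) \<le> exp (L * t) * norm (\<Phi> 0 z - \<Phi> 0 z0)"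
      proof (rule gronwall_trajectories[where f=f])
        fix s assume s: "0 \<le> s" "s \<le> t"
        have "norm (\<Phi> s z0) \<le> R" using R s that by auto
        moreover have "norm (\<Phi> s z) \<le> norm (\<Phi> s z0) + norm (\<Phi> s z - \<Phi> s z0)"
          by (metis add_diff_cancel_left' diff_add_cancel norm_triangle_ineq add.commute)
        ultimately show "norm (f (\<Phi> s z) - f (\<Phi> s z0)) \<le> L * norm (\<Phi> s z - \<Phi> s z0)"
          using that(3)[OF s] by (intro L) auto
      qed (use der that z0 in auto)
      then show ?thesis by (simp add: zero that z0)
    qed
    have stay: "norm (\<Phi> t z - \<Phi> t z0) < 1"
      if z: "z \<in> D" "dist z z0 < exp (- L * T)" and t: "t \<in> {0..T}" for z t
    proof (rule ccontr)
      let ?n = "\<lambda>s. norm (\<Phi> s z - \<Phi> s z0)"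
      assume "\<not> ?n t < 1"
      define A where "A = {s \<in> {0..T}. 1 \<le> ?n s}"
      have "continuous_on {0..T} ?n"
        by (intro continuous_intros continuous_on_subset[OF cont] z z0) auto
      then have "closed A"
        using continuous_closed_preimage[of "{0..T}" ?n "{1..}"]
        by (simp add: A_def vimage_def Int_def)
      moreover have "t \<in> A" using t \<open>\<not> ?n t < 1\<close> by (simp add: A_def)
      moreover have bdd: "bdd_below A" by (rule bdd_belowI[of _ 0]) (simp add: A_def)
      ultimately have inf: "Inf A \<in> A" by (intro closed_contains_Inf) auto
      have small: "?n s < 1" if "0 \<le> s" "s < Inf A" for s
      proof (rule ccontr)
        assume "\<not> ?n s < 1"
        then have "s \<in> A" using that inf by (auto simp: A_def)
        then show False using cInf_lower[OF _ bdd, of s] that by simp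
      qed
      have n_cont: "continuous_on {0..Inf A} ?n"
        using inf by (intro continuous_intros continuous_on_subset[OF cont] z z0) auto
      have "?n 0 \<le> 1" "1 \<le> ?n (Inf A)" "0 \<le> Inf A" "Inf A \<le> T"
        using z L(1) T inf order.strict_trans2[of "dist z z0" "exp (- L * T)" 1]
        by (auto simp: A_def zero z0 dist_norm)
      \<comment> \<open>At the first time with distance at least one the distance equals one.\<close>
      with IVT'[OF this(1-3) n_cont] obtain s where "0 \<le> s" "s \<le> Inf A" "?n s = 1"
        by auto
      then have one: "?n (Inf A) = 1"
        using small[of s] by (cases "s = Inf A") auto
      have "?n s \<le> 1" if "0 \<le> s" "s \<le> Inf A" for s
        using small[of s] one that by (cases "s = Inf A") auto
      then have "?n (Inf A) \<le> exp (L * Inf A) * norm (z - z0)"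
        using inf by (intro gron z) (auto simp: A_def)
      also have "\<dots> < exp (L * Inf A) * exp (- L * T)"
        using z by (simp add: dist_norm)
      also have "\<dots> \<le> exp 0"
        using L(1) \<open>Inf A \<le> T\<close> by (simp add: exp_add[symmetric] mult_left_mono)
      finally show False using one by simp
    qed
    show ?thesis
    proof (rule exI[of _ "exp (- L * T)"], rule conjI, simp, rule exI[of _ "exp (L * T)"],
        rule conjI, simp, intro ballI impI)
      fix z t assume z: "z \<in> D" "dist z z0 < exp (- L * T)" and t: "t \<in> {0..T}"
      have "norm (\<Phi> t z - \<Phi> t z0) \<le> exp (L * t) * norm (z - z0)"
        using t by (intro gron z) (auto intro!: less_imp_le[OF stay[OF z]])
      also have "\<dots> \<le> exp (L * T) * norm (z - z0)"
        using t L(1) by (intro mult_right_mono) (auto intro: mult_left_mono)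
      finally show "dist (\<Phi> t z) (\<Phi> t z0) \<le> exp (L * T) * dist z z0"
        by (simp add: dist_norm)
    qed
  qed
  show ?thesis
    unfolding continuous_on_def
  proof (rule ballI)
    fix p0 :: "real \<times> (real^'n)" assume "p0 \<in> {0..} \<times> D"
    then obtain t0 z0 where p0: "p0 = (t0, z0)" and t0: "t0 \<in> {0..}" and z0: "z0 \<in> D"
      by auto
    let ?F = "at (t0, z0) within {0..} \<times> D"
    obtain \<delta> K where \<delta>: "0 < \<delta>" "0 < K"
      and K: "\<And>t z. z \<in> D \<Longrightarrow> dist z z0 < \<delta> \<Longrightarrow> t \<in> {0..t0 + 1} \<Longrightarrow> dist (\<Phi> t z) (\<Phi> t z0) \<le> K * dist z z0"
      using near[OF z0, of "t0 + 1"] t0 by auto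
    let ?g = "\<lambda>p. K * dist (snd p) z0 + dist (\<Phi> (fst p) z0) (\<Phi> t0 z0)"
    have "continuous_on ({0..} \<times> D) ?g"
      by (intro continuous_intros continuous_on_compose2[OF cont[OF z0] continuous_on_fst]) auto
    then have "(?g \<longlongrightarrow> ?g (t0, z0)) ?F"
      unfolding continuous_on_def using t0 z0 by blast
    then have g: "(?g \<longlongrightarrow> 0) ?F"
      by simp
    have "\<forall>\<^sub>F p in ?F. norm (dist (case p of (t, z) \<Rightarrow> \<Phi> t z) (\<Phi> t0 z0)) \<le> ?g p"
      unfolding eventually_at
    proof (intro exI[of _ "min \<delta> 1"] conjI ballI impI)
      fix p :: "real \<times> (real^'n)" assume p: "p \<in> {0..} \<times> D" "p \<noteq> (t0, z0) \<and> dist p (t0, z0) < min \<delta> 1"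
      then have "dist (snd p) z0 < \<delta>" "dist (fst p) t0 < 1"
        using dist_snd_le[of p "(t0, z0)"] dist_fst_le[of p "(t0, z0)"] by auto
      then have "dist (\<Phi> (fst p) (snd p)) (\<Phi> (fst p) z0) \<le> K * dist (snd p) z0"
        using p by (intro K) (auto simp: dist_real_def)
      then show "norm (dist (case p of (t, z) \<Rightarrow> \<Phi> t z) (\<Phi> t0 z0)) \<le> ?g p"
        using dist_triangle[of "\<Phi> (fst p) (snd p)" "\<Phi> t0 z0" "\<Phi> (fst p) z0"]
        by (simp add: case_prod_beta)
    qed (use \<delta> in auto)
    then have "((\<lambda>p. dist (case p of (t, z) \<Rightarrow> \<Phi> t z) (\<Phi> t0 z0)) \<longlongrightarrow> 0) ?F"
      by (rule Lim_null_comparison[OF _ g])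
    then show "((\<lambda>(t, z). \<Phi> t z) \<longlongrightarrow> (case p0 of (t, z) \<Rightarrow> \<Phi> t z)) (at p0 within {0..} \<times> D)"
      unfolding p0 by (subst tendsto_dist_iff) simp
  qed
qed

section \<open>Borel versions of Lebesgue measurable functions\<close>

lemma AE_lebesgue_on_iff:
  assumes "S \<in> sets borel"
  shows "(AE x in lebesgue_on S. P x) \<longleftrightarrow> (AE x in lborel. x \<in> S \<longrightarrow> P x)"
  using assms by (subst AE_restrict_space_iff) (auto simp: AE_completion_iff)

lemma lebesgue_on_borel_version:
  fixes h :: "'a::euclidean_space \<Rightarrow> real"
  assumes S: "S \<in> sets borel" and h: "h \<in> borel_measurable (lebesgue_on S)"
  obtains h' where "h' \<in> borel_measurable borel" "AE x in lborel. x \<in> S \<longrightarrow> h x = h' x"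
proof -
  have "(\<lambda>x. indicator S x *\<^sub>R h x) \<in> borel_measurable lebesgue"
    using S h by (subst (asm) borel_measurable_restrict_space_iff) auto
  from completion_ex_borel_measurable_real[OF this]
  obtain h' where h': "h' \<in> borel_measurable lborel" "AE x in lborel. indicator S x *\<^sub>R h x = h' x"
    by auto
  show ?thesis
  proof (rule that[of h'])
    show "AE x in lborel. x \<in> S \<longrightarrow> h x = h' x"
      using h'(2) by eventually_elim (auto simp: indicator_def)
  qed (use h'(1) in simp)
qed

lemma measurable_lebesgue_on_AE:
  fixes h :: "'a::euclidean_space \<Rightarrow> 'b::topological_space"
  assumes S: "S \<in> sets borel" and h': "h' \<in> borel_measurable borel"
    and eq: "AE x in lborel. x \<in> S \<longrightarrow> h x = h' x"
  shows "h \<in> borel_measurable (lebesgue_on S)"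
proof (rule measurableI)
  fix B :: "'b set" assume B: "B \<in> sets borel"
  have "S \<inter> h -` B \<in> sets lebesgue"
  proof (rule completion.in_sets_AE)
    have "S \<inter> h' -` B \<in> sets borel"
      using measurable_sets[OF h' B] S by auto
    then show "S \<inter> h' -` B \<in> sets lebesgue" by auto
    show "AE x in lebesgue. (x \<in> S \<inter> h' -` B) = (x \<in> S \<inter> h -` B)"
      unfolding AE_completion_iff using eq by eventually_elim auto
  qed auto
  then show "h -` B \<inter> space (lebesgue_on S) \<in> sets (lebesgue_on S)"
    using S by (auto simp: sets_restrict_space_iff Int_commute)
qed auto

text \<open>
Lebesgue measurability is not preserved by composition with a continuous map such as the flow, so
integrals over \<open>\<Omega>\<close> are rewritten in terms of Borel representatives.
\<close>
lemma lebesgue_on_to_lborel: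
  fixes h :: "'a::euclidean_space \<Rightarrow> real"
  assumes S: "S \<in> sets borel" and h': "h' \<in> borel_measurable borel"
    and eq: "AE x in lborel. x \<in> S \<longrightarrow> h x = h' x"
  shows integral_lebesgue_on_eq_lborel: "(LINT x|lebesgue_on S. h x) = (LINT x|lborel. indicator S x * h' x)"
    and integrable_lebesgue_on_iff_lborel: "integrable (lebesgue_on S) h \<longleftrightarrow> integrable lborel (\<lambda>x. indicator S x * h' x)"
proof -
  note [measurable] = h' S
  have h: "h \<in> borel_measurable (lebesgue_on S)"
    by (rule measurable_lebesgue_on_AE[OF assms])
  have h'': "h' \<in> borel_measurable (lebesgue_on S)"
    by (rule measurable_lebesgue_on_AE[OF S h']) auto
  have AE: "AE x in lebesgue_on S. h x = h' x"
    using eq S by (simp add: AE_lebesgue_on_iff)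
  have m: "(\<lambda>x. indicator S x * h' x) \<in> borel_measurable lborel"
    by simp
  show "(LINT x|lebesgue_on S. h x) = (LINT x|lborel. indicator S x * h' x)"
    using S integral_cong_AE[OF h h'' AE]
    by (simp add: integral_restrict_space integral_completion[OF m])
  show "integrable (lebesgue_on S) h \<longleftrightarrow> integrable lborel (\<lambda>x. indicator S x * h' x)"
    using S integrable_cong_AE[OF h h'' AE]
    by (simp add: integrable_restrict_space integrable_completion[OF m])
qed

section \<open>Weighted spaces\<close>

lemma wLinfI:
  assumes "\<phi> \<in> borel_measurable (lebesgue_on \<Omega>)" "w \<in> borel_measurable (lebesgue_on \<Omega>)"
    "AE x in lebesgue_on \<Omega>. \<bar>\<phi> x * w x\<bar> \<le> K"
  shows "\<phi> \<in> wLinf \<Omega> w"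
proof -
  have "esssup (lebesgue_on \<Omega>) (\<lambda>x. ereal \<bar>\<phi> x * w x\<bar>) \<le> ereal K"
    using assms by (intro esssup_I) auto
  also have "\<dots> < \<infinity>" by simp
  finally show ?thesis using assms(1) by (simp add: wLinf_def)
qed

lemma wLinf_AE:
  assumes "\<phi> \<in> wLinf \<Omega> w"
  shows "AE x in lebesgue_on \<Omega>. \<bar>\<phi> x * w x\<bar> \<le> wLinf_norm \<Omega> w \<phi>"
proof -
  have fin: "esssup (lebesgue_on \<Omega>) (\<lambda>x. ereal \<bar>\<phi> x * w x\<bar>) < \<infinity>"
    using assms by (simp add: wLinf_def)
  show ?thesis
    using esssup_AE[of "\<lambda>x. ereal \<bar>\<phi> x * w x\<bar>" "lebesgue_on \<Omega>"]
  proof eventually_elim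
    case (elim x)
    then show ?case
      using fin unfolding wLinf_norm_def
      by (cases "esssup (lebesgue_on \<Omega>) (\<lambda>x. ereal \<bar>\<phi> x * w x\<bar>)") auto
  qed
qed

text \<open>
The operator norm is an infimum over admissible bounds, so the inequality is obtained up to an
arbitrarily small error.
\<close>
lemma X_opnorm_bound:
  assumes "X_opnorm \<Omega> w T \<le> ereal K" "\<rho> \<in> wLp 1 \<Omega> w"
  shows "wLp_norm 1 \<Omega> w (T \<rho>) \<le> K * wLp_norm 1 \<Omega> w \<rho>"
proof (rule field_le_epsilon)
  fix e :: real assume "0 < e"
  let ?n = "wLp_norm 1 \<Omega> w \<rho>"
  have n: "0 \<le> ?n" by (simp add: wLp_norm_def)
  define d where "d = e / (?n + 1)"
  have d: "0 < d" "d * ?n \<le> e"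
    using n \<open>0 < e\<close> by (auto simp: d_def field_simps)
  have "X_opnorm \<Omega> w T < ereal (K + d)"
    using assms(1) d by (intro le_less_trans[OF assms(1)]) auto
  then obtain K' where K': "K' < K + d" "\<forall>\<rho>\<in>wLp 1 \<Omega> w. wLp_norm 1 \<Omega> w (T \<rho>) \<le> K' * wLp_norm 1 \<Omega> w \<rho>"
    unfolding X_opnorm_def Inf_less_iff by auto
  then have "wLp_norm 1 \<Omega> w (T \<rho>) \<le> K' * ?n" using assms(2) by auto
  also have "\<dots> \<le> (K + d) * ?n" using K' n by (intro mult_right_mono) auto
  also have "\<dots> \<le> K * ?n + e" using d by (simp add: distrib_right)
  finally show "wLp_norm 1 \<Omega> w (T \<rho>) \<le> K * ?n + e" .
qed

section \<open>Decay along trajectories\<close>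

text \<open>
The operator norms are bounded by a general function \<open>K\<close> of time; exponential decay will matter
only through the square integrability of \<open>K\<close>.
\<close>
locale stable_transport =
  fixes \<Omega> :: "(real^'n) set" and w :: "real^'n \<Rightarrow> real"
    and \<Phi> :: "real \<Rightarrow> real^'n \<Rightarrow> real^'n"
    and S :: "real \<Rightarrow> (real^'n \<Rightarrow> real) \<Rightarrow> (real^'n \<Rightarrow> real)"
    and K :: "real \<Rightarrow> real"
  assumes open_\<Omega>: "open \<Omega>" and bounded_\<Omega>: "bounded \<Omega>"
    and w_meas: "w \<in> borel_measurable (lebesgue_on \<Omega>)"
    and w_pos: "AE x in lebesgue_on \<Omega>. 0 < w x"
    and w_inv: "(\<lambda>x. inverse (w x)) \<in> wLinf \<Omega> (\<lambda>_. 1)"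
    and \<Phi>_cont: "continuous_on ({0..} \<times> \<Omega>) (\<lambda>(t, z). \<Phi> t z)"
    and preadj: "preadjoint_semigroup \<Omega> w \<Phi> S"
    and K_bound: "\<And>t. 0 \<le> t \<Longrightarrow> X_opnorm \<Omega> w (S t) \<le> ereal (K t)"
    and K_meas: "K \<in> borel_measurable borel"
begin

abbreviation N :: "(real^'n) measure" where "N \<equiv> lebesgue_on \<Omega>"

lemma \<Omega>_borel [measurable]: "\<Omega> \<in> sets borel"
  using open_\<Omega> by simp

lemma w_meas' [measurable]: "w \<in> borel_measurable N"
  by (rule w_meas)

sublocale N: finite_measure N
proof
  have "emeasure lebesgue \<Omega> < \<infinity>"
    using emeasure_bounded_finite[OF bounded_\<Omega>] by simp
  then show "emeasure N (space N) \<noteq> \<infinity>"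
    by (simp add: emeasure_restrict_space)
qed

lemma borel_measurable_N: "h \<in> borel_measurable borel \<Longrightarrow> h \<in> borel_measurable N"
  by (rule measurable_lebesgue_on_AE[OF \<Omega>_borel]) auto

lemma AE_N_iff: "(AE x in N. P x) \<longleftrightarrow> (AE x in lborel. x \<in> \<Omega> \<longrightarrow> P x)"
  by (rule AE_lebesgue_on_iff) simp

text \<open>
Extended by zero so that it is Borel measurable on the whole product space.
\<close>
definition flow :: "real \<times> (real^'n) \<Rightarrow> real^'n" where
  "flow p = indicator ({0..} \<times> \<Omega>) p *\<^sub>R (case p of (t, z) \<Rightarrow> \<Phi> t z)"

lemma flow_measurable [measurable]: "flow \<in> borel_measurable borel"
  unfolding flow_def[abs_def]
  by (intro borel_measurable_continuous_on_indicator \<Phi>_cont) (simp add: borel_Times)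

lemma flow_eq: "0 \<le> t \<Longrightarrow> z \<in> \<Omega> \<Longrightarrow> flow (t, z) = \<Phi> t z"
  by (simp add: flow_def)

lemma \<Phi>_measurable:
  assumes "0 \<le> t"
  shows "\<Phi> t \<in> borel_measurable N"
proof (rule measurable_lebesgue_on_AE[OF \<Omega>_borel])
  show "(\<lambda>z. flow (t, z)) \<in> borel_measurable borel"
    by (rule measurable_compose[OF _ flow_measurable]) (simp add: borel_prod[symmetric])
qed (use assms flow_eq in auto)

lemma wLp_1_iff: "\<rho> \<in> wLp 1 \<Omega> w \<longleftrightarrow> \<rho> \<in> borel_measurable N \<and> integrable N (\<lambda>x. \<bar>\<rho> x\<bar> * w x)"
  by (simp add: wLp_def)

lemma wLp_norm_1: "wLp_norm 1 \<Omega> w \<rho> = (LINT x|N. \<bar>\<rho> x\<bar> * w x)"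
proof -
  have "0 \<le> (LINT x|N. \<bar>\<rho> x\<bar> * w x)"
    using w_pos by (intro integral_nonneg_AE) (auto elim!: eventually_mono)
  then show ?thesis by (simp add: wLp_norm_def)
qed

text \<open>
The function \<open>1\<^sub>B\<close> is zero in \<open>X\<^sup>*\<close>, hence so is \<open>1\<^sub>B \<circ> \<Phi> t\<close> by duality. With \<open>\<rho> = w\<^sup>-\<^sup>2\<close> the pairing
is the Lebesgue measure of the initial values that are mapped into \<open>B\<close>. As \<open>B\<close> may contain the
complement of \<open>\<Omega>\<close>, this yields both preservation of null sets and invariance of \<open>\<Omega>\<close> up to null
sets.
\<close>
lemma flow_avoids_null_set:
  assumes B: "B \<in> sets borel" "AE x in lborel. x \<in> \<Omega> \<longrightarrow> x \<notin> B" and t: "0 \<le> t"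
  shows "AE z in lborel. z \<in> \<Omega> \<longrightarrow> \<Phi> t z \<notin> B"
proof -
  let ?\<rho> = "\<lambda>x. (inverse (w x))\<^sup>2"
  let ?\<phi> = "indicator B :: real^'n \<Rightarrow> real"
  note [measurable] = \<Phi>_measurable[OF t] B(1)
  have \<phi>_meas [measurable]: "?\<phi> \<in> borel_measurable N"
    by (rule borel_measurable_N) simp
  have \<phi>0: "AE x in N. ?\<phi> x = 0"
    using B(2) unfolding AE_N_iff by eventually_elim simp
  have "integrable N (\<lambda>x. inverse (w x))"
    using wLinf_AE[OF w_inv] by (intro N.integrable_const_bound) auto
  then have "integrable N (\<lambda>x. \<bar>?\<rho> x\<bar> * w x)"
    using w_pos by (subst integrable_cong_AE[where g="\<lambda>x. inverse (w x)"])
      (auto elim!: eventually_mono simp: power2_eq_square)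
  then have \<rho>: "?\<rho> \<in> wLp 1 \<Omega> w"
    by (simp add: wLp_1_iff)
  have \<phi>: "?\<phi> \<in> wLinf \<Omega> w"
    using \<phi>0 by (intro wLinfI[where K=0]) (auto elim!: eventually_mono)
  have "pairing \<Omega> w ?\<rho> (?\<phi> \<circ> \<Phi> t) = pairing \<Omega> w (S t ?\<rho>) ?\<phi>"
    using preadj \<rho> \<phi> t by (simp add: preadjoint_semigroup_def)
  also have "\<dots> = 0"
    unfolding pairing_def using \<phi>0 by (intro integral_eq_zero_AE) (auto elim!: eventually_mono)
  also have "pairing \<Omega> w ?\<rho> (?\<phi> \<circ> \<Phi> t) = (LINT x|N. indicator B (\<Phi> t x))"
    unfolding pairing_def
  proof (intro integral_cong_AE)
    show "AE x in N. ?\<rho> x * (?\<phi> \<circ> \<Phi> t) x * (w x)\<^sup>2 = indicator B (\<Phi> t x)"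
      using w_pos by eventually_elim (simp add: power2_eq_square field_simps)
  qed measurable
  finally have "(LINT x|N. indicator B (\<Phi> t x) :: real) = 0" .
  moreover have "integrable N (\<lambda>x. indicator B (\<Phi> t x) :: real)"
    by (intro N.integrable_const_bound[where B=1]) (auto simp: indicator_def)
  ultimately have "AE x in N. indicator B (\<Phi> t x) = (0::real)"
    by (subst (asm) integral_nonneg_eq_0_iff_AE) auto
  then show ?thesis
    unfolding AE_N_iff by (auto elim!: eventually_mono simp: indicator_def split: if_splits)
qed

text \<open>
Here \<open>V\<close> stands for \<open>1 / w\<close>, a unit vector of \<open>X\<^sup>*\<close>. Testing the duality against
\<open>\<rho> = 1\<^sub>E V\<close>, where \<open>E\<close> is the set on which the claim fails, bounds the average of \<open>V (\<Phi> t z) w z\<close>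
over \<open>E\<close> by \<open>K t\<close>, so \<open>E\<close> is null. The sets \<open>E n\<close> truncate \<open>E\<close> to keep the integrals finite.
\<close>
lemma flow_decay:
  assumes V: "V \<in> borel_measurable borel" "AE x in lborel. x \<in> \<Omega> \<longrightarrow> V x * w x = 1" and t: "0 \<le> t"
  shows "AE z in lborel. z \<in> \<Omega> \<longrightarrow> V (\<Phi> t z) * w z \<le> K t"
proof -
  note [measurable] = \<Phi>_measurable[OF t] V(1) borel_measurable_N[OF V(1)]
  have Vw: "AE x in N. V x * w x = 1"
    using V(2) by (simp add: AE_N_iff)
  define E where "E n = {z \<in> \<Omega>. K t < V (\<Phi> t z) * w z \<and> V (\<Phi> t z) * w z \<le> real n}" for n :: nat
  have E_eq: "E n = {z \<in> space N. K t < V (\<Phi> t z) * w z \<and> V (\<Phi> t z) * w z \<le> real n}" for n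
    by (simp add: E_def)
  have [measurable]: "E n \<in> sets N" for n
    unfolding E_eq by measurable
  have "AE z in N. z \<notin> E n" for n
  proof -
    let ?\<rho> = "\<lambda>z. indicator (E n) z * V z"
    have \<rho>1: "AE z in N. \<bar>?\<rho> z\<bar> * w z = indicator (E n) z"
      using Vw w_pos
    proof eventually_elim
      case (elim z)
      then have "0 < V z" using zero_less_mult_pos2[of "V z" "w z"] by simp
      then show ?case using elim by (auto simp: abs_mult indicator_def)
    qed
    have int1: "integrable N (indicator (E n) :: _ \<Rightarrow> real)"
      by (intro N.integrable_const_bound[where B=1]) auto
    have \<rho>: "?\<rho> \<in> wLp 1 \<Omega> w"
      unfolding wLp_1_iff using \<rho>1 int1 by (auto simp: integrable_cong_AE[OF _ _ \<rho>1])
    have V\<phi>: "V \<in> wLinf \<Omega> w"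
      using Vw by (intro wLinfI[where K=1]) (auto elim!: eventually_mono)
    have S\<rho>: "S t ?\<rho> \<in> wLp 1 \<Omega> w"
      using preadj \<rho> t by (simp add: preadjoint_semigroup_def X_bounded_ops_def)
    have [measurable]: "S t ?\<rho> \<in> borel_measurable N" using S\<rho> by (simp add: wLp_1_iff)
    have "(LINT z|N. indicator (E n) z * (V (\<Phi> t z) * w z)) = pairing \<Omega> w ?\<rho> (V \<circ> \<Phi> t)"
      unfolding pairing_def
    proof (intro integral_cong_AE)
      show "AE z in N. indicator (E n) z * (V (\<Phi> t z) * w z) = ?\<rho> z * (V \<circ> \<Phi> t) z * (w z)\<^sup>2"
        using Vw
      proof eventually_elim
        case (elim z)
        have "?\<rho> z * (V \<circ> \<Phi> t) z * (w z)\<^sup>2 = indicator (E n) z * (V (\<Phi> t z) * w z) * (V z * w z)"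
          by (simp add: power2_eq_square)
        then show ?case by (simp only: elim mult_1_right)
      qed
    qed measurable
    also have "\<dots> = pairing \<Omega> w (S t ?\<rho>) V"
      using preadj \<rho> V\<phi> t by (simp add: preadjoint_semigroup_def)
    also have "\<dots> = (LINT z|N. S t ?\<rho> z * w z)"
      unfolding pairing_def
    proof (intro integral_cong_AE)
      show "AE z in N. S t ?\<rho> z * V z * (w z)\<^sup>2 = S t ?\<rho> z * w z"
        using Vw
      proof eventually_elim
        case (elim z)
        have "S t ?\<rho> z * V z * (w z)\<^sup>2 = S t ?\<rho> z * w z * (V z * w z)"
          by (simp add: power2_eq_square)
        then show ?case by (simp only: elim mult_1_right)
      qed
    qed measurable
    also have "\<dots> \<le> \<bar>LINT z|N. S t ?\<rho> z * w z\<bar>" by simp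
    also have "\<dots> \<le> (LINT z|N. \<bar>S t ?\<rho> z * w z\<bar>)"
      by (rule integral_abs_bound)
    also have "\<dots> = wLp_norm 1 \<Omega> w (S t ?\<rho>)"
      unfolding wLp_norm_1 using w_pos by (intro integral_cong_AE) (auto elim!: eventually_mono simp: abs_mult)
    also have "\<dots> \<le> K t * wLp_norm 1 \<Omega> w ?\<rho>"
      by (rule X_opnorm_bound[OF K_bound[OF t] \<rho>])
    also have "\<dots> = (LINT z|N. K t * indicator (E n) z)"
      unfolding wLp_norm_1 by (subst integral_cong_AE[OF _ _ \<rho>1]) auto
    finally have le: "(LINT z|N. indicator (E n) z * (V (\<Phi> t z) * w z)) \<le> (LINT z|N. K t * indicator (E n) z)" .
    have int2: "integrable N (\<lambda>z. indicator (E n) z * (V (\<Phi> t z) * w z))"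
    proof (rule N.integrable_const_bound)
      show "AE z in N. norm (indicator (E n) z * (V (\<Phi> t z) * w z)) \<le> max \<bar>K t\<bar> (real n)"
        by (rule AE_I2) (auto simp: indicator_def E_def)
    qed measurable
    have int3: "integrable N (\<lambda>z. indicator (E n) z * (V (\<Phi> t z) * w z - K t))"
      using Bochner_Integration.integrable_diff[OF int2 integrable_mult_right[OF int1, of "K t"]]
      by (simp add: right_diff_distrib mult.commute)
    have "(LINT z|N. indicator (E n) z * (V (\<Phi> t z) * w z - K t)) \<le> 0"
      using le int2 integrable_mult_right[OF int1, of "K t"]
      by (simp add: right_diff_distrib mult.commute[of _ "K t"])
    moreover have "0 \<le> indicator (E n) z * (V (\<Phi> t z) * w z - K t)" for z
      by (auto simp: indicator_def E_def)
    ultimately have "(LINT z|N. indicator (E n) z * (V (\<Phi> t z) * w z - K t)) = 0"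
      by (intro antisym integral_nonneg_AE) auto
    then have "AE z in N. indicator (E n) z * (V (\<Phi> t z) * w z - K t) = 0"
      using int3 by (subst (asm) integral_nonneg_eq_0_iff_AE) (auto simp: indicator_def E_def)
    then show ?thesis
      by eventually_elim (auto simp: indicator_def E_def split: if_splits)
  qed
  then have "AE z in N. \<forall>n. z \<notin> E n"
    by (simp add: AE_all_countable)
  then have "AE z in lborel. z \<in> \<Omega> \<longrightarrow> (\<forall>n. z \<notin> E n)"
    by (simp add: AE_N_iff)
  then show ?thesis
  proof eventually_elim
    case (elim z)
    obtain n where "V (\<Phi> t z) * w z \<le> real n"
      using real_arch_simple by blast
    then show ?case using elim by (auto simp: E_def not_less)
  qed
qed

text \<open>
The kernel is \<open>c i (\<Phi> t z) w z\<close>, computed from Borel representatives and set to zero on \<open>Bad\<close>, so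
that its bound holds everywhere. The set \<open>Bad\<close> collects the pairs for which \<open>z\<close> or \<open>\<Phi> t z\<close> is exceptional
or the decay estimate fails. It is Borel in the product, and its slices at fixed times are null;
Fubini's theorem then makes almost all of its slices at fixed \<open>z\<close> null as well.
\<close>
lemma trajectory_kernel:
  fixes c :: "nat \<Rightarrow> real^'n \<Rightarrow> real" and \<kappa> :: "nat \<Rightarrow> real"
  assumes c_meas: "\<And>i. c i \<in> borel_measurable N"
    and c_bound: "\<And>i. AE x in N. \<bar>c i x * w x\<bar> \<le> \<kappa> i"
    and \<kappa>: "\<And>i. 0 \<le> \<kappa> i" and K_nonneg: "\<And>t. 0 \<le> K t"
  obtains D :: "nat \<Rightarrow> real \<times> (real^'n) \<Rightarrow> real" and Bad
  where "\<And>i. D i \<in> borel_measurable borel" "Bad \<in> sets borel"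
    "\<And>t. 0 \<le> t \<Longrightarrow> AE z in lborel. z \<in> \<Omega> \<longrightarrow> (t, z) \<notin> Bad"
    "\<And>i t z. \<bar>D i (t, z)\<bar> \<le> indicator {0..} t * K t * \<kappa> i"
    "\<And>i t z. z \<notin> \<Omega> \<Longrightarrow> D i (t, z) = 0"
    "\<And>t z. 0 \<le> t \<Longrightarrow> z \<in> \<Omega> \<Longrightarrow> (t, z) \<notin> Bad \<Longrightarrow>
        \<Phi> t z \<in> \<Omega> \<and> 0 < w z \<and> (\<forall>i. D i (t, z) = c i (\<Phi> t z) * w z)"
proof -
  obtain W where W [measurable]: "W \<in> borel_measurable borel" and wW: "AE x in lborel. x \<in> \<Omega> \<longrightarrow> w x = W x"
    using lebesgue_on_borel_version[OF \<Omega>_borel w_meas] .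
  have "\<exists>C. C \<in> borel_measurable borel \<and> (AE x in lborel. x \<in> \<Omega> \<longrightarrow> c i x = C x)" for i
    using lebesgue_on_borel_version[OF \<Omega>_borel c_meas[of i]] by blast
  then obtain C where C [measurable]: "\<And>i. C i \<in> borel_measurable borel"
    and cC: "\<And>i. AE x in lborel. x \<in> \<Omega> \<longrightarrow> c i x = C i x"
    by metis
  have "AE x in lborel. x \<in> \<Omega> \<longrightarrow> w x = W x \<and> 0 < w x \<and> (\<forall>i. c i x = C i x \<and> \<bar>c i x * w x\<bar> \<le> \<kappa> i)"
  proof -
    have "AE x in lborel. \<forall>i. x \<in> \<Omega> \<longrightarrow> c i x = C i x"
      "AE x in lborel. \<forall>i. x \<in> \<Omega> \<longrightarrow> \<bar>c i x * w x\<bar> \<le> \<kappa> i"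
      "AE x in lborel. x \<in> \<Omega> \<longrightarrow> 0 < w x"
      using cC c_bound w_pos unfolding AE_N_iff AE_all_countable by blast+
    then show ?thesis using wW by eventually_elim blast
  qed
  then obtain Z where Z: "Z \<in> null_sets lborel"
    and good: "\<And>x. x \<in> \<Omega> \<Longrightarrow> x \<notin> Z \<Longrightarrow> w x = W x \<and> 0 < w x \<and> (\<forall>i. c i x = C i x \<and> \<bar>c i x * w x\<bar> \<le> \<kappa> i)"
    by (rule AE_E3) auto
  have [measurable]: "Z \<in> sets borel" using Z by auto
  have Z_AE: "AE x in lborel. x \<notin> Z" using Z by (rule AE_not_in)
  define V where "V x = inverse (W x)" for x
  have [measurable]: "V \<in> borel_measurable borel" by (simp add: V_def[abs_def])
  have Vw: "AE x in lborel. x \<in> \<Omega> \<longrightarrow> V x * w x = 1"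
    using Z_AE by eventually_elim (use good in \<open>force simp: V_def\<close>)
  note [measurable] = K_meas flow_measurable[folded borel_prod]
  define Bad where "Bad = {p. 0 \<le> fst p \<and> snd p \<in> \<Omega> \<and>
      (snd p \<in> Z \<or> flow p \<in> Z \<union> - \<Omega> \<or> K (fst p) < V (flow p) * W (snd p))}"
  have Bad_pair [measurable]: "Bad \<in> sets (borel \<Otimes>\<^sub>M borel)"
  proof -
    have "Bad = {p \<in> space (borel \<Otimes>\<^sub>M borel). 0 \<le> fst p \<and> snd p \<in> \<Omega> \<and>
      (snd p \<in> Z \<or> flow p \<in> Z \<union> - \<Omega> \<or> K (fst p) < V (flow p) * W (snd p))}"
      by (simp add: Bad_def space_pair_measure)
    also have "\<dots> \<in> sets (borel \<Otimes>\<^sub>M borel)" by measurable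
    finally show ?thesis .
  qed
  define D where "D i p = (if 0 \<le> fst p \<and> snd p \<in> \<Omega> \<and> p \<notin> Bad then C i (flow p) * W (snd p) else 0)" for i p
  have good_point: "\<Phi> t z \<in> \<Omega> \<and> 0 < w z \<and> (\<forall>i. D i (t, z) = c i (\<Phi> t z) * w z \<and> \<bar>D i (t, z)\<bar> \<le> K t * \<kappa> i)"
    if tz: "0 \<le> t" "z \<in> \<Omega>" "(t, z) \<notin> Bad" for t z
  proof -
    have z: "z \<notin> Z" "\<Phi> t z \<notin> Z" "\<Phi> t z \<in> \<Omega>" "V (\<Phi> t z) * W z \<le> K t"
      using tz by (auto simp: Bad_def flow_eq)
    note gz = good[OF tz(2) z(1)] and g\<Phi> = good[OF z(3,2)]
    have "D i (t, z) = c i (\<Phi> t z) * w z" for i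
      using tz gz g\<Phi> by (simp add: D_def flow_eq)
    moreover have "\<bar>c i (\<Phi> t z) * w z\<bar> \<le> K t * \<kappa> i" for i
    proof -
      have "\<bar>c i (\<Phi> t z) * w z\<bar> = (V (\<Phi> t z) * W z) * \<bar>c i (\<Phi> t z) * w (\<Phi> t z)\<bar>"
        using gz g\<Phi> by (simp add: abs_mult V_def field_simps)
      also have "\<dots> \<le> K t * \<kappa> i"
      proof (intro mult_mono z(4) K_nonneg)
        show "\<bar>c i (\<Phi> t z) * w (\<Phi> t z)\<bar> \<le> \<kappa> i" using g\<Phi> by blast
      qed simp
      finally show ?thesis .
    qed
    ultimately show ?thesis using z gz by simp
  qed
  show ?thesis
  proof (rule that[of D Bad])
    show "D i \<in> borel_measurable borel" for i
      unfolding D_def[abs_def] borel_prod[symmetric] by measurable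
    show "Bad \<in> sets borel"
      using Bad_pair by (simp only: borel_prod)
    show "AE z in lborel. z \<in> \<Omega> \<longrightarrow> (t, z) \<notin> Bad" if t: "0 \<le> t" for t
    proof -
      have "AE z in lborel. z \<in> \<Omega> \<longrightarrow> \<Phi> t z \<notin> Z \<union> - \<Omega>"
        using Z_AE by (intro flow_avoids_null_set t) (auto elim!: eventually_mono)
      with Z_AE flow_decay[OF \<open>V \<in> borel_measurable borel\<close> Vw t] show ?thesis
        by eventually_elim (use good t in \<open>force simp: Bad_def flow_eq\<close>)
    qed
    show "\<bar>D i (t, z)\<bar> \<le> indicator {0..} t * K t * \<kappa> i" for i t z
    proof (cases "0 \<le> t \<and> z \<in> \<Omega> \<and> (t, z) \<notin> Bad")
      case True
      then have "\<bar>D i (t, z)\<bar> \<le> K t * \<kappa> i" using good_point[of t z] by blast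
      then show ?thesis using True by simp
    next
      case False
      then have "D i (t, z) = 0" by (auto simp: D_def)
      then show ?thesis using \<kappa> K_nonneg by simp
    qed
    show "D i (t, z) = 0" if "z \<notin> \<Omega>" for i t z
      using that by (simp add: D_def)
    show "\<Phi> t z \<in> \<Omega> \<and> 0 < w z \<and> (\<forall>i. D i (t, z) = c i (\<Phi> t z) * w z)"
      if "0 \<le> t" "z \<in> \<Omega>" "(t, z) \<notin> Bad" for t z
      using good_point[OF that] by simp
  qed
qed

end

section \<open>Kernels square summable along trajectories\<close>

lemma suminf_swap_ennreal:
  fixes f :: "nat \<Rightarrow> nat \<Rightarrow> ennreal"
  shows "(\<Sum>i. \<Sum>j. f i j) = (\<Sum>j. \<Sum>i. f i j)"
proof -
  have "(\<Sum>i. \<Sum>j. f i j) = (\<integral>\<^sup>+ i. (\<Sum>j. f i j) \<partial>count_space UNIV)"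
    by (simp add: nn_integral_count_space_nat)
  also have "\<dots> = (\<Sum>j. \<integral>\<^sup>+ i. f i j \<partial>count_space UNIV)"
    by (rule nn_integral_suminf) simp
  finally show ?thesis by (simp add: nn_integral_count_space_nat)
qed

lemma parseval_ennreal:
  assumes "(\<lambda>k. (L2_inner M f (e k))\<^sup>2) sums L2_inner M f f" "f \<in> L2 M"
  shows "(\<Sum>k. ennreal ((L2_inner M f (e k))\<^sup>2)) = (\<integral>\<^sup>+x. ennreal ((f x)\<^sup>2) \<partial>M)"
proof -
  have "(\<integral>\<^sup>+x. ennreal ((f x)\<^sup>2) \<partial>M) = ennreal (L2_inner M f f)"
    using assms(2) by (simp add: L2_def L2_inner_def nn_integral_eq_integral power2_eq_square)
  moreover have "(\<Sum>k. ennreal ((L2_inner M f (e k))\<^sup>2)) = ennreal (L2_inner M f f)"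
    using assms(1) by (intro suminf_ennreal_eq) auto
  ultimately show ?thesis by simp
qed

text \<open>
The setting after the weight has been absorbed: \<open>D i (t, z)\<close> is the \<open>i\<close>-th output at time \<open>t\<close> of a
unit mass at \<open>z\<close>.
\<close>
locale square_summable_kernel =
  fixes D :: "nat \<Rightarrow> real \<times> 'a::euclidean_space \<Rightarrow> real" and \<Omega> :: "'a set"
    and \<beta> :: "real \<Rightarrow> real" and \<kappa> :: "nat \<Rightarrow> real"
  assumes D_borel: "\<And>i. D i \<in> borel_measurable borel"
    and D_bound: "\<And>i t z. \<bar>D i (t, z)\<bar> \<le> \<beta> t * \<kappa> i"
    and D_outside: "\<And>i t z. z \<notin> \<Omega> \<Longrightarrow> D i (t, z) = 0"
    and \<beta>_L2: "\<beta> \<in> L2 lborel" and \<beta>_nonneg: "\<And>t. 0 \<le> \<beta> t"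
    and \<kappa>_nonneg: "\<And>i. 0 \<le> \<kappa> i" and \<kappa>_summable: "summable (\<lambda>i. (\<kappa> i)\<^sup>2)"
    and \<Omega>_borel': "\<Omega> \<in> sets borel" and \<Omega>_finite: "emeasure lborel \<Omega> < \<infinity>"
begin

lemma D_meas [measurable]: "D i \<in> borel_measurable (borel \<Otimes>\<^sub>M borel)"
  using D_borel by (simp add: borel_prod)

lemma \<beta>_meas [measurable]: "\<beta> \<in> borel_measurable borel"
  using L2_measurable[OF \<beta>_L2] by simp

declare \<Omega>_borel' [measurable]

text \<open>
The \<open>i\<close>-th output, as a function of time, that the initial density \<open>\<phi>\<close> generates.
\<close>
definition out :: "nat \<Rightarrow> ('a \<Rightarrow> real) \<Rightarrow> real \<Rightarrow> real" where
  "out i \<phi> t = (LINT z|lborel. \<phi> z * D i (t, z))"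

definition value_integral :: "('a \<Rightarrow> real) \<Rightarrow> ('a \<Rightarrow> real) \<Rightarrow> real" where
  "value_integral \<phi> \<psi> = (LINT t|lborel. (\<Sum>i. out i \<phi> t * out i \<psi> t))"

lemma out_integrable:
  assumes "integrable lborel \<phi>"
  shows "integrable lborel (\<lambda>z. \<phi> z * D i (t, z))"
proof (rule Bochner_Integration.integrable_bound)
  show "integrable lborel (\<lambda>z. (\<beta> t * \<kappa> i) * \<phi> z)" using assms by simp
  have [measurable]: "\<phi> \<in> borel_measurable borel" using borel_measurable_integrable[OF assms] by simp
  show "(\<lambda>z. \<phi> z * D i (t, z)) \<in> borel_measurable lborel" by measurable
  show "AE z in lborel. norm (\<phi> z * D i (t, z)) \<le> norm ((\<beta> t * \<kappa> i) * \<phi> z)"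
    using D_bound \<beta>_nonneg \<kappa>_nonneg
    by (intro AE_I2) (simp add: abs_mult mult.commute[of "\<bar>\<phi> _\<bar>"] mult_right_mono)
qed

lemma out_meas [measurable]:
  assumes [measurable]: "\<phi> \<in> borel_measurable borel"
  shows "out i \<phi> \<in> borel_measurable borel"
  unfolding out_def[abs_def] by measurable

lemma out_bound:
  assumes "integrable lborel \<phi>"
  shows "\<bar>out i \<phi> t\<bar> \<le> (\<beta> t * (LINT z|lborel. \<bar>\<phi> z\<bar>)) * \<kappa> i"
proof -
  have "\<bar>out i \<phi> t\<bar> \<le> (LINT z|lborel. \<bar>\<phi> z * D i (t, z)\<bar>)"
    unfolding out_def by (rule integral_abs_bound)
  also have "\<dots> \<le> (LINT z|lborel. (\<beta> t * \<kappa> i) * \<bar>\<phi> z\<bar>)"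
  proof (rule integral_mono)
    show "integrable lborel (\<lambda>z. \<bar>\<phi> z * D i (t, z)\<bar>)"
      using out_integrable[OF assms] by simp
    show "integrable lborel (\<lambda>z. (\<beta> t * \<kappa> i) * \<bar>\<phi> z\<bar>)"
      using assms by simp
    show "\<bar>\<phi> z * D i (t, z)\<bar> \<le> (\<beta> t * \<kappa> i) * \<bar>\<phi> z\<bar>" for z
      using mult_right_mono[OF D_bound[of i t z], of "\<bar>\<phi> z\<bar>"] by (simp add: abs_mult ac_simps)
  qed
  finally show ?thesis by (simp add: ac_simps)
qed

lemma out_add:
  assumes "integrable lborel \<phi>" "integrable lborel \<psi>"
  shows "out i (\<lambda>z. \<phi> z + \<psi> z) t = out i \<phi> t + out i \<psi> t"
  using out_integrable[OF assms(1)] out_integrable[OF assms(2)]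
  by (simp add: out_def distrib_right)

lemma out_diff:
  assumes "integrable lborel \<phi>" "integrable lborel \<psi>"
  shows "out i (\<lambda>z. \<phi> z - \<psi> z) t = out i \<phi> t - out i \<psi> t"
  using out_integrable[OF assms(1)] out_integrable[OF assms(2)]
  by (simp add: out_def left_diff_distrib)

lemma out_L2:
  assumes "integrable lborel \<phi>"
  shows "out i \<phi> \<in> L2 lborel"
proof (rule L2_dominated[OF L2_scale[OF \<beta>_L2, of "(LINT z|lborel. \<bar>\<phi> z\<bar>) * \<kappa> i"]])
  show "out i \<phi> \<in> borel_measurable lborel"
    using borel_measurable_integrable[OF assms] by simp
  show "\<bar>out i \<phi> t\<bar> \<le> \<bar>(LINT z|lborel. \<bar>\<phi> z\<bar>) * \<kappa> i * \<beta> t\<bar>" for t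
    using out_bound[OF assms, of i t] by (simp add: ac_simps)
qed

lemma out_product_bound:
  assumes "integrable lborel \<phi>" "integrable lborel \<psi>"
  shows "\<bar>out i \<phi> t * out i \<psi> t\<bar>
      \<le> ((\<beta> t)\<^sup>2 * ((LINT z|lborel. \<bar>\<phi> z\<bar>) * (LINT z|lborel. \<bar>\<psi> z\<bar>))) * (\<kappa> i)\<^sup>2"
proof -
  have "\<bar>out i \<phi> t\<bar> * \<bar>out i \<psi> t\<bar>
      \<le> ((\<beta> t * (LINT z|lborel. \<bar>\<phi> z\<bar>)) * \<kappa> i) * ((\<beta> t * (LINT z|lborel. \<bar>\<psi> z\<bar>)) * \<kappa> i)"
    using \<beta>_nonneg \<kappa>_nonneg by (intro mult_mono out_bound assms) auto
  then show ?thesis by (simp add: abs_mult power2_eq_square ac_simps)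
qed

lemma out_product_summable:
  assumes "integrable lborel \<phi>" "integrable lborel \<psi>"
  shows "summable (\<lambda>i. \<bar>out i \<phi> t * out i \<psi> t\<bar>)"
  using out_product_bound[OF assms]
  by (intro summable_comparison_test'[OF summable_mult[OF \<kappa>_summable]]) auto

lemma value_integrand_integrable:
  assumes "integrable lborel \<phi>" "integrable lborel \<psi>"
  shows "integrable lborel (\<lambda>t. \<Sum>i. out i \<phi> t * out i \<psi> t)"
proof (rule Bochner_Integration.integrable_bound)
  let ?c = "(LINT z|lborel. \<bar>\<phi> z\<bar>) * (LINT z|lborel. \<bar>\<psi> z\<bar>) * (\<Sum>i. (\<kappa> i)\<^sup>2)"
  have [measurable]: "\<phi> \<in> borel_measurable borel" "\<psi> \<in> borel_measurable borel"
    using assms[THEN borel_measurable_integrable] by simp_all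
  show "integrable lborel (\<lambda>t. ?c * (\<beta> t)\<^sup>2)"
    using \<beta>_L2 by (simp add: L2_def)
  show "(\<lambda>t. \<Sum>i. out i \<phi> t * out i \<psi> t) \<in> borel_measurable lborel" by measurable
  show "AE t in lborel. norm (\<Sum>i. out i \<phi> t * out i \<psi> t) \<le> norm (?c * (\<beta> t)\<^sup>2)"
  proof (rule AE_I2)
    fix t
    have "\<bar>\<Sum>i. out i \<phi> t * out i \<psi> t\<bar> \<le> (\<Sum>i. \<bar>out i \<phi> t * out i \<psi> t\<bar>)"
      by (rule summable_rabs[OF out_product_summable[OF assms]])
    also have "\<dots> \<le> (\<Sum>i. ((\<beta> t)\<^sup>2 * ((LINT z|lborel. \<bar>\<phi> z\<bar>) * (LINT z|lborel. \<bar>\<psi> z\<bar>))) * (\<kappa> i)\<^sup>2)"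
      by (intro suminf_le out_product_bound assms out_product_summable summable_mult \<kappa>_summable)
    also have "\<dots> = ?c * (\<beta> t)\<^sup>2"
      by (subst suminf_mult[OF \<kappa>_summable]) (simp add: ac_simps)
    finally show "norm (\<Sum>i. out i \<phi> t * out i \<psi> t) \<le> norm (?c * (\<beta> t)\<^sup>2)"
      by simp
  qed
qed

lemma value_integral_diag:
  assumes "integrable lborel \<phi>"
  shows "(\<integral>\<^sup>+t. (\<Sum>i. ennreal ((out i \<phi> t)\<^sup>2)) \<partial>lborel) = ennreal (value_integral \<phi> \<phi>)"
    and "0 \<le> value_integral \<phi> \<phi>"
proof -
  have sm: "summable (\<lambda>i. out i \<phi> t * out i \<phi> t)" for t
    by (rule summable_rabs_cancel[OF out_product_summable[OF assms assms]])
  then have nonneg: "0 \<le> (\<Sum>i. out i \<phi> t * out i \<phi> t)" for t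
    by (intro suminf_nonneg) auto
  have "(\<Sum>i. ennreal ((out i \<phi> t)\<^sup>2)) = ennreal (\<Sum>i. out i \<phi> t * out i \<phi> t)" for t
    using sm[of t] by (intro suminf_ennreal_eq) (auto simp: power2_eq_square summable_sums)
  then show "(\<integral>\<^sup>+t. (\<Sum>i. ennreal ((out i \<phi> t)\<^sup>2)) \<partial>lborel) = ennreal (value_integral \<phi> \<phi>)"
    unfolding value_integral_def
    using nonneg value_integrand_integrable[OF assms assms] by (simp add: nn_integral_eq_integral)
  show "0 \<le> value_integral \<phi> \<phi>"
    unfolding value_integral_def using nonneg by simp
qed

lemma value_integral_polarization:
  assumes \<phi>: "integrable lborel \<phi>" and \<psi>: "integrable lborel \<psi>"
  shows "4 * value_integral \<phi> \<psi> =
    value_integral (\<lambda>z. \<phi> z + \<psi> z) (\<lambda>z. \<phi> z + \<psi> z) - value_integral (\<lambda>z. \<phi> z - \<psi> z) (\<lambda>z. \<phi> z - \<psi> z)"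
proof -
  let ?p = "\<lambda>z. \<phi> z + \<psi> z" and ?m = "\<lambda>z. \<phi> z - \<psi> z"
  have p: "integrable lborel ?p" and m: "integrable lborel ?m" using assms by auto
  have "4 * (\<Sum>i. out i \<phi> t * out i \<psi> t) = (\<Sum>i. out i ?p t * out i ?p t) - (\<Sum>i. out i ?m t * out i ?m t)" for t
  proof -
    note sm = out_product_summable[THEN summable_rabs_cancel]
    have "(\<Sum>i. out i ?p t * out i ?p t) - (\<Sum>i. out i ?m t * out i ?m t)
        = (\<Sum>i. out i ?p t * out i ?p t - out i ?m t * out i ?m t)"
      by (rule suminf_diff[OF sm[OF p p] sm[OF m m]])
    also have "\<dots> = (\<Sum>i. 4 * (out i \<phi> t * out i \<psi> t))"
      using assms by (simp add: out_add out_diff algebra_simps)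
    also have "\<dots> = 4 * (\<Sum>i. out i \<phi> t * out i \<psi> t)"
      by (rule suminf_mult[OF sm[OF \<phi> \<psi>]])
    finally show ?thesis by simp
  qed
  then have "(LINT t|lborel. 4 * (\<Sum>i. out i \<phi> t * out i \<psi> t))
      = (LINT t|lborel. (\<Sum>i. out i ?p t * out i ?p t) - (\<Sum>i. out i ?m t * out i ?m t))"
    by simp
  then show ?thesis
    unfolding value_integral_def
    using value_integrand_integrable[OF p p] value_integrand_integrable[OF m m] by simp
qed

text \<open>
The diagonal of the kernel that represents \<open>value_integral\<close>.
\<close>
definition gram_trace :: "'a \<Rightarrow> ennreal" where
  "gram_trace z = (\<integral>\<^sup>+t. (\<Sum>i. ennreal ((D i (t, z))\<^sup>2)) \<partial>lborel)"

lemma gram_trace_meas [measurable]: "gram_trace \<in> borel_measurable borel"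
  unfolding gram_trace_def[abs_def] by measurable

lemma gram_trace_bound:
  "gram_trace z \<le> ennreal ((\<Sum>i. (\<kappa> i)\<^sup>2) * L2_inner lborel \<beta> \<beta>)"
proof -
  have "gram_trace z \<le> (\<integral>\<^sup>+t. ennreal ((\<Sum>i. (\<kappa> i)\<^sup>2) * (\<beta> t)\<^sup>2) \<partial>lborel)"
    unfolding gram_trace_def
  proof (rule nn_integral_mono)
    fix t
    have "(D i (t, z))\<^sup>2 \<le> (\<kappa> i)\<^sup>2 * (\<beta> t)\<^sup>2" for i
      using D_bound[of i t z] \<beta>_nonneg \<kappa>_nonneg
      by (subst power_mult_distrib[symmetric], subst power2_abs[symmetric], intro power_mono)
         (auto simp: mult.commute)
    then have "(\<Sum>i. ennreal ((D i (t, z))\<^sup>2)) \<le> (\<Sum>i. ennreal ((\<kappa> i)\<^sup>2 * (\<beta> t)\<^sup>2))"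
      by (intro suminf_le) (auto intro: ennreal_leI)
    also have "\<dots> = ennreal ((\<Sum>i. (\<kappa> i)\<^sup>2) * (\<beta> t)\<^sup>2)"
      using \<kappa>_summable by (intro suminf_ennreal_eq) (auto intro: sums_mult2 summable_sums)
    finally show "(\<Sum>i. ennreal ((D i (t, z))\<^sup>2)) \<le> ennreal ((\<Sum>i. (\<kappa> i)\<^sup>2) * (\<beta> t)\<^sup>2)" .
  qed
  also have "\<dots> = ennreal ((\<Sum>i. (\<kappa> i)\<^sup>2) * L2_inner lborel \<beta> \<beta>)"
    using \<beta>_L2 \<kappa>_summable
    by (subst nn_integral_eq_integral)
       (auto simp: L2_def L2_inner_def power2_eq_square[symmetric] intro!: mult_nonneg_nonneg suminf_nonneg)
  finally show ?thesis .
qed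

lemma D_slice_t_L2: "(\<lambda>t. D i (t, z)) \<in> L2 lborel"
proof (rule L2_dominated[OF L2_scale[OF \<beta>_L2, of "\<kappa> i"]])
  show "(\<lambda>t. D i (t, z)) \<in> borel_measurable lborel" by simp
  show "\<bar>D i (t, z)\<bar> \<le> \<bar>\<kappa> i * \<beta> t\<bar>" for t
    using D_bound[of i t z] \<beta>_nonneg[of t] \<kappa>_nonneg[of i] by (simp add: abs_mult mult.commute)
qed

lemma indicator_L2_lborel:
  "A \<in> sets borel \<Longrightarrow> A \<subseteq> \<Omega> \<Longrightarrow> indicator A \<in> L2 lborel"
  using emeasure_mono[of A \<Omega> lborel] \<Omega>_finite
  by (simp add: L2_def power2_eq_square indicator_inter_arith[symmetric] integrable_indicator_iff)

lemma bounded_on_\<Omega>_L2: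
  assumes "A \<in> sets borel" "A \<subseteq> \<Omega>" "f \<in> borel_measurable borel" "\<And>z. \<bar>f z\<bar> \<le> C * indicator A z"
  shows "f \<in> L2 lborel"
proof (rule L2_dominated[OF L2_scale[OF indicator_L2_lborel[OF assms(1,2)], of C]])
  show "\<bar>f z\<bar> \<le> \<bar>C * indicator A z\<bar>" for z using assms(4)[of z] by linarith
qed (use assms in simp)

text \<open>
The value form determines the kernel only almost everywhere in the product, where the diagonal is a
null set. The trace over a measurable set \<open>A\<close> is nevertheless determined: by Parseval's identity both
sides, integrated over \<open>A\<close>, are the sum of the values of the form at \<open>1\<^sub>A e\<^sub>k\<close>. All terms are
nonnegative, so sums and integrals may be interchanged freely.
\<close>
lemma diagonal_unique:
  fixes P :: "nat \<Rightarrow> 'a \<Rightarrow> real"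
  assumes P_L2: "\<And>i. P i \<in> L2 lborel" and P_out: "\<And>i z. z \<notin> \<Omega> \<Longrightarrow> P i z = 0"
    and dec: "\<And>\<phi>. integrable lborel \<phi> \<Longrightarrow> (\<And>z. z \<notin> \<Omega> \<Longrightarrow> \<phi> z = 0) \<Longrightarrow>
        (\<lambda>i. (LINT z|lborel. \<phi> z * P i z)\<^sup>2) sums value_integral \<phi> \<phi>"
  shows "AE z in lborel. (\<Sum>i. ennreal ((P i z)\<^sup>2)) = gram_trace z"
proof (rule sigma_finite_measure.density_unique[OF sigma_finite_lborel])
  have P_meas [measurable]: "P i \<in> borel_measurable borel" for i
    using L2_measurable[OF P_L2] by simp
  show "(\<lambda>z. \<Sum>i. ennreal ((P i z)\<^sup>2)) \<in> borel_measurable lborel" by measurable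
  show "gram_trace \<in> borel_measurable lborel" by simp
  obtain e :: "nat \<Rightarrow> 'a \<Rightarrow> real" where e: "\<And>k. e k \<in> L2 lborel"
    and pars: "\<And>f. f \<in> L2 lborel \<Longrightarrow> (\<lambda>k. (L2_inner lborel f (e k))\<^sup>2) sums L2_inner lborel f f"
    using parseval_sequence_lborel by blast
  have [measurable]: "e k \<in> borel_measurable borel" for k
    using L2_measurable[OF e] by simp
  show "density lborel (\<lambda>z. \<Sum>i. ennreal ((P i z)\<^sup>2)) = density lborel gram_trace"
  proof (rule measure_eqI)
    fix A assume "A \<in> sets (density lborel (\<lambda>z. \<Sum>i. ennreal ((P i z)\<^sup>2)))"
    then have A [measurable]: "A \<in> sets borel" by simp
    let ?E = "A \<inter> \<Omega>"
    have E [measurable]: "?E \<in> sets borel" by simp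
    define \<phi> where "\<phi> k z = indicator ?E z * e k z" for k z
    have \<phi>_int: "integrable lborel (\<phi> k)" for k
      unfolding \<phi>_def[abs_def] by (intro L2_mult_integrable indicator_L2_lborel e) auto
    have restrict: "L2_inner lborel (\<lambda>z. indicator ?E z * f z) (e k) = (LINT z|lborel. \<phi> k z * f z)" for f k
      unfolding L2_inner_def \<phi>_def by (intro Bochner_Integration.integral_cong) auto
    have PE_L2: "(\<lambda>z. indicator ?E z * P i z) \<in> L2 lborel" for i
      by (rule L2_dominated[OF P_L2[of i]]) (auto simp: indicator_def)
    have DE_L2: "(\<lambda>z. indicator ?E z * D i (t, z)) \<in> L2 lborel" for i t
      using D_bound[of i t] \<beta>_nonneg \<kappa>_nonneg
      by (intro bounded_on_\<Omega>_L2[of ?E _ "\<beta> t * \<kappa> i"]) (auto simp: indicator_def)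
    have "emeasure (density lborel (\<lambda>z. \<Sum>i. ennreal ((P i z)\<^sup>2))) A
        = (\<integral>\<^sup>+z. (\<Sum>i. ennreal ((P i z)\<^sup>2)) * indicator A z \<partial>lborel)"
      by (simp add: emeasure_density)
    also have "\<dots> = (\<integral>\<^sup>+z. (\<Sum>i. ennreal ((indicator ?E z * P i z)\<^sup>2)) \<partial>lborel)"
    proof (rule nn_integral_cong)
      show "(\<Sum>i. ennreal ((P i z)\<^sup>2)) * indicator A z = (\<Sum>i. ennreal ((indicator ?E z * P i z)\<^sup>2))" for z
        by (cases "z \<in> A"; cases "z \<in> \<Omega>") (simp_all add: P_out)
    qed
    also have "\<dots> = (\<Sum>i. \<integral>\<^sup>+z. ennreal ((indicator ?E z * P i z)\<^sup>2) \<partial>lborel)"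
      by (rule nn_integral_suminf) simp
    also have "\<dots> = (\<Sum>i. \<Sum>k. ennreal ((LINT z|lborel. \<phi> k z * P i z)\<^sup>2))"
      by (simp only: parseval_ennreal[OF pars[OF PE_L2] PE_L2, symmetric] restrict)
    also have "\<dots> = (\<Sum>k. \<Sum>i. ennreal ((LINT z|lborel. \<phi> k z * P i z)\<^sup>2))"
      by (rule suminf_swap_ennreal)
    also have "\<dots> = (\<Sum>k. ennreal (value_integral (\<phi> k) (\<phi> k)))"
      by (intro arg_cong[where f=suminf] ext suminf_ennreal_eq dec \<phi>_int) (auto simp: \<phi>_def)
    also have "\<dots> = (\<Sum>k. \<integral>\<^sup>+t. (\<Sum>i. ennreal ((out i (\<phi> k) t)\<^sup>2)) \<partial>lborel)"
      by (simp only: value_integral_diag(1)[OF \<phi>_int])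
    also have "\<dots> = (\<integral>\<^sup>+t. (\<Sum>k. \<Sum>i. ennreal ((out i (\<phi> k) t)\<^sup>2)) \<partial>lborel)"
      using borel_measurable_integrable[OF \<phi>_int] by (intro nn_integral_suminf[symmetric]) simp
    also have "\<dots> = (\<integral>\<^sup>+t. (\<Sum>i. \<Sum>k. ennreal ((out i (\<phi> k) t)\<^sup>2)) \<partial>lborel)"
      by (subst suminf_swap_ennreal) simp
    also have "\<dots> = (\<integral>\<^sup>+t. (\<Sum>i. \<integral>\<^sup>+z. ennreal ((indicator ?E z * D i (t, z))\<^sup>2) \<partial>lborel) \<partial>lborel)"
      by (simp only: parseval_ennreal[OF pars[OF DE_L2] DE_L2, symmetric] restrict out_def)
    also have "\<dots> = (\<integral>\<^sup>+t. (\<integral>\<^sup>+z. (\<Sum>i. ennreal ((indicator ?E z * D i (t, z))\<^sup>2)) \<partial>lborel) \<partial>lborel)"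
      by (intro nn_integral_cong nn_integral_suminf[symmetric]) simp
    also have "\<dots> = (\<integral>\<^sup>+z. (\<integral>\<^sup>+t. (\<Sum>i. ennreal ((indicator ?E z * D i (t, z))\<^sup>2)) \<partial>lborel) \<partial>lborel)"
      by (rule lborel_pair.Fubini'[symmetric]) simp
    also have "\<dots> = (\<integral>\<^sup>+z. gram_trace z * indicator A z \<partial>lborel)"
    proof (rule nn_integral_cong)
      show "(\<integral>\<^sup>+t. (\<Sum>i. ennreal ((indicator ?E z * D i (t, z))\<^sup>2)) \<partial>lborel) = gram_trace z * indicator A z" for z
        by (cases "z \<in> A"; cases "z \<in> \<Omega>") (simp_all add: D_outside gram_trace_def)
    qed
    also have "\<dots> = emeasure (density lborel gram_trace) A"
      by (simp add: emeasure_density)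
    finally show "emeasure (density lborel (\<lambda>z. \<Sum>i. ennreal ((P i z)\<^sup>2))) A = emeasure (density lborel gram_trace) A" .
  qed simp
qed

text \<open>
Expand each \<open>t \<mapsto> D i (t, z)\<close> along a Parseval sequence in time and enumerate the coefficients by
pairs \<open>(i, k)\<close>. Parseval's identity, applied to the output generated by \<open>\<phi>\<close>, gives the
decomposition on the diagonal \<open>\<phi> = \<psi>\<close>; polarisation gives the rest.
\<close>
lemma decomposition_exists:
  obtains q :: "nat \<Rightarrow> 'a \<Rightarrow> real" and C where
    "\<And>n. q n \<in> borel_measurable borel" "\<And>n z. \<bar>q n z\<bar> \<le> C n * indicator \<Omega> z"
    "summable (\<lambda>n. LINT z|lborel. (q n z)\<^sup>2)"
    "\<And>\<phi> \<psi>. integrable lborel \<phi> \<Longrightarrow> integrable lborel \<psi> \<Longrightarrow>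
      (\<lambda>n. (LINT z|lborel. \<phi> z * q n z) * (LINT z|lborel. \<psi> z * q n z)) sums value_integral \<phi> \<psi>"
proof -
  obtain e :: "nat \<Rightarrow> real \<Rightarrow> real" where e: "\<And>k. e k \<in> L2 lborel"
    and pars: "\<And>f. f \<in> L2 lborel \<Longrightarrow> (\<lambda>k. (L2_inner lborel f (e k))\<^sup>2) sums L2_inner lborel f f"
    using parseval_sequence_lborel by blast
  have [measurable]: "e k \<in> borel_measurable borel" for k
    using L2_measurable[OF e] by simp
  define r where "r i k z = L2_inner lborel (\<lambda>t. D i (t, z)) (e k)" for i k z
  have [measurable]: "r i k \<in> borel_measurable borel" for i k
    unfolding r_def[abs_def] L2_inner_def by measurable
  define q where "q n = (case prod_decode n of (i, k) \<Rightarrow> r i k)" for n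
  have q_meas [measurable]: "q n \<in> borel_measurable borel" for n
    unfolding q_def by (cases "prod_decode n") simp
  have trace: "(\<Sum>n. ennreal ((q n z)\<^sup>2)) = gram_trace z" for z
  proof -
    have "(\<Sum>n. ennreal ((q n z)\<^sup>2)) = (\<Sum>n. case prod_decode n of (i, k) \<Rightarrow> ennreal ((r i k z)\<^sup>2))"
      by (intro arg_cong[where f=suminf] ext) (simp add: q_def case_prod_beta)
    also have "\<dots> = (\<Sum>i. \<Sum>k. ennreal ((r i k z)\<^sup>2))"
      by (rule suminf_ennreal_2dimen) simp
    also have "\<dots> = (\<Sum>i. \<integral>\<^sup>+t. ennreal ((D i (t, z))\<^sup>2) \<partial>lborel)"
      unfolding r_def by (simp only: parseval_ennreal[OF pars[OF D_slice_t_L2] D_slice_t_L2])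
    also have "\<dots> = gram_trace z"
      unfolding gram_trace_def by (rule nn_integral_suminf[symmetric]) simp
    finally show ?thesis .
  qed
  define B where "B = (\<Sum>i. (\<kappa> i)\<^sup>2) * L2_inner lborel \<beta> \<beta>"
  have B: "0 \<le> B"
    unfolding B_def by (intro mult_nonneg_nonneg suminf_nonneg \<kappa>_summable L2_inner_nonneg) simp
  have q_out: "q n z = 0" if "z \<notin> \<Omega>" for n z
    by (cases "prod_decode n") (simp add: q_def r_def L2_inner_def D_outside[OF that])
  have q_bound: "\<bar>q n z\<bar> \<le> sqrt B * indicator \<Omega> z" for n z
  proof (cases "z \<in> \<Omega>")
    case True
    have "(\<Sum>m\<in>{n}. ennreal ((q m z)\<^sup>2)) \<le> (\<Sum>m. ennreal ((q m z)\<^sup>2))"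
      by (rule sum_le_suminf) auto
    then have "ennreal ((q n z)\<^sup>2) \<le> (\<Sum>m. ennreal ((q m z)\<^sup>2))"
      by (simp only: sum.insert_remove sum.empty finite.emptyI Diff_empty Diff_insert0 empty_iff
          not_False_eq_True add_0_right Diff_cancel)
    also have "\<dots> \<le> ennreal B"
      unfolding trace B_def by (rule gram_trace_bound)
    finally have "(q n z)\<^sup>2 \<le> B" using B by simp
    then have "\<bar>q n z\<bar> \<le> sqrt B" by (rule real_le_rsqrt[of "\<bar>q n z\<bar>", unfolded power2_abs])
    then show ?thesis using True by simp
  qed (simp add: q_out)
  have q_L2: "q n \<in> L2 lborel" for n
    by (rule bounded_on_\<Omega>_L2[OF \<Omega>_borel' order.refl q_meas q_bound])
  have q_sum: "summable (\<lambda>n. LINT z|lborel. (q n z)\<^sup>2)"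
  proof (rule summable_suminf_not_top)
    have "(\<Sum>n. ennreal (LINT z|lborel. (q n z)\<^sup>2)) = (\<Sum>n. \<integral>\<^sup>+z. ennreal ((q n z)\<^sup>2) \<partial>lborel)"
      using q_L2 by (simp add: nn_integral_eq_integral L2_def)
    also have "\<dots> = (\<integral>\<^sup>+z. (\<Sum>n. ennreal ((q n z)\<^sup>2)) \<partial>lborel)"
      by (rule nn_integral_suminf[symmetric]) simp
    also have "\<dots> \<le> (\<integral>\<^sup>+z. ennreal B * indicator \<Omega> z \<partial>lborel)"
    proof (rule nn_integral_mono)
      show "(\<Sum>n. ennreal ((q n z)\<^sup>2)) \<le> ennreal B * indicator \<Omega> z" for z
      proof (cases "z \<in> \<Omega>")
        case True
        have "(\<Sum>n. ennreal ((q n z)\<^sup>2)) \<le> ennreal B"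
          unfolding trace B_def by (rule gram_trace_bound)
        then show ?thesis using True by simp
      next
        case False
        then have "q n z = 0" for n by (rule q_out)
        then show ?thesis by simp
      qed
    qed
    also have "\<dots> = ennreal B * emeasure lborel \<Omega>"
      by (simp add: nn_integral_cmult_indicator)
    also have "\<dots> < \<infinity>"
      using \<Omega>_finite by (simp add: ennreal_mult_less_top)
    finally show "(\<Sum>n. ennreal (LINT z|lborel. (q n z)\<^sup>2)) \<noteq> top" by simp
  qed simp
  have fubini: "(LINT z|lborel. \<phi> z * r i k z) = L2_inner lborel (out i \<phi>) (e k)"
    if \<phi>: "integrable lborel \<phi>" for \<phi> i k
  proof -
    have [measurable]: "\<phi> \<in> borel_measurable borel" using borel_measurable_integrable[OF \<phi>] by simp
    have int: "integrable (lborel \<Otimes>\<^sub>M lborel) (\<lambda>(t, z). \<phi> z * D i (t, z) * e k t)"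
    proof (rule Bochner_Integration.integrable_bound)
      have be: "integrable lborel (\<lambda>t. \<beta> t * e k t)"
        by (rule L2_mult_integrable[OF \<beta>_L2 e])
      show "integrable (lborel \<Otimes>\<^sub>M lborel) (\<lambda>(t, z). \<beta> t * e k t * (\<kappa> i * \<phi> z))"
      proof (rule lborel_pair.Fubini_integrable)
        show "integrable lborel (\<lambda>t. LINT z|lborel. norm (case (t, z) of (t, z) \<Rightarrow> \<beta> t * e k t * (\<kappa> i * \<phi> z)))"
          using integrable_abs[OF be] by (simp add: abs_mult)
        show "AE t in lborel. integrable lborel (\<lambda>z. case (t, z) of (t, z) \<Rightarrow> \<beta> t * e k t * (\<kappa> i * \<phi> z))"
          using \<phi> by simp
      qed simp
      show "AE p in lborel \<Otimes>\<^sub>M lborel. norm (case p of (t, z) \<Rightarrow> \<phi> z * D i (t, z) * e k t)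
          \<le> norm (case p of (t, z) \<Rightarrow> \<beta> t * e k t * (\<kappa> i * \<phi> z))"
      proof (rule AE_I2)
        fix p :: "real \<times> 'a"
        obtain t z where p: "p = (t, z)" by (cases p)
        have "\<bar>D i (t, z)\<bar> * (\<bar>\<phi> z\<bar> * \<bar>e k t\<bar>) \<le> (\<beta> t * \<kappa> i) * (\<bar>\<phi> z\<bar> * \<bar>e k t\<bar>)"
          by (intro mult_right_mono D_bound) simp
        then show "norm (case p of (t, z) \<Rightarrow> \<phi> z * D i (t, z) * e k t)
          \<le> norm (case p of (t, z) \<Rightarrow> \<beta> t * e k t * (\<kappa> i * \<phi> z))"
          using \<beta>_nonneg[of t] \<kappa>_nonneg[of i] by (simp add: p abs_mult ac_simps)
      qed
    qed simp
    have "(LINT z|lborel. \<phi> z * r i k z) = (LINT z|lborel. LINT t|lborel. \<phi> z * D i (t, z) * e k t)"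
      unfolding r_def L2_inner_def by (simp add: mult.assoc)
    also have "\<dots> = (LINT t|lborel. LINT z|lborel. \<phi> z * D i (t, z) * e k t)"
      by (rule lborel_pair.Fubini_integral[OF int])
    also have "\<dots> = L2_inner lborel (out i \<phi>) (e k)"
      unfolding L2_inner_def out_def by simp
    finally show ?thesis .
  qed
  have diag: "(\<lambda>n. (LINT z|lborel. \<phi> z * q n z)\<^sup>2) sums value_integral \<phi> \<phi>"
    if \<phi>: "integrable lborel \<phi>" for \<phi>
  proof -
    have [measurable]: "\<phi> \<in> borel_measurable borel" using borel_measurable_integrable[OF \<phi>] by simp
    have "(\<Sum>n. ennreal ((LINT z|lborel. \<phi> z * q n z)\<^sup>2))
        = (\<Sum>n. case prod_decode n of (i, k) \<Rightarrow> ennreal ((LINT z|lborel. \<phi> z * r i k z)\<^sup>2))"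
      by (intro arg_cong[where f=suminf] ext) (simp add: q_def case_prod_beta)
    also have "\<dots> = (\<Sum>i. \<Sum>k. ennreal ((LINT z|lborel. \<phi> z * r i k z)\<^sup>2))"
      by (rule suminf_ennreal_2dimen) simp
    also have "\<dots> = (\<Sum>i. \<integral>\<^sup>+t. ennreal ((out i \<phi> t)\<^sup>2) \<partial>lborel)"
      unfolding fubini[OF \<phi>] by (simp only: parseval_ennreal[OF pars[OF out_L2[OF \<phi>]] out_L2[OF \<phi>]])
    also have "\<dots> = (\<integral>\<^sup>+t. (\<Sum>i. ennreal ((out i \<phi> t)\<^sup>2)) \<partial>lborel)"
      by (rule nn_integral_suminf[symmetric]) simp
    also have "\<dots> = ennreal (value_integral \<phi> \<phi>)"
      by (rule value_integral_diag(1)[OF \<phi>])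
    finally have "(\<lambda>n. ennreal ((LINT z|lborel. \<phi> z * q n z)\<^sup>2)) sums ennreal (value_integral \<phi> \<phi>)"
      by (metis summableI summable_sums)
    then show ?thesis
      using value_integral_diag(2)[OF \<phi>] by (subst (asm) sums_ennreal) auto
  qed
  have q_int: "integrable lborel (\<lambda>z. \<phi> z * q n z)" if \<phi>: "integrable lborel \<phi>" for \<phi> n
  proof (rule Bochner_Integration.integrable_bound)
    show "integrable lborel (\<lambda>z. sqrt B * \<phi> z)" using \<phi> by simp
    show "(\<lambda>z. \<phi> z * q n z) \<in> borel_measurable lborel"
      using borel_measurable_integrable[OF \<phi>] by simp
    have "\<bar>q n z\<bar> \<le> sqrt B" for z
      using q_bound[of n z] B by (cases "z \<in> \<Omega>") simp_all
    then show "AE z in lborel. norm (\<phi> z * q n z) \<le> norm (sqrt B * \<phi> z)"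
      using B by (intro AE_I2) (simp add: abs_mult mult.commute[of "\<bar>\<phi> _\<bar>"] mult_right_mono)
  qed
  show ?thesis
  proof (rule that[OF q_meas q_bound q_sum])
    fix \<phi> \<psi> :: "'a \<Rightarrow> real" assume \<phi>: "integrable lborel \<phi>" and \<psi>: "integrable lborel \<psi>"
    let ?I = "\<lambda>\<phi> n. LINT z|lborel. \<phi> z * q n z"
    have p: "integrable lborel (\<lambda>z. \<phi> z + \<psi> z)" and m: "integrable lborel (\<lambda>z. \<phi> z - \<psi> z)"
      using \<phi> \<psi> by auto
    have "(\<lambda>n. ((?I (\<lambda>z. \<phi> z + \<psi> z) n)\<^sup>2 - (?I (\<lambda>z. \<phi> z - \<psi> z) n)\<^sup>2) / 4) sums
        ((value_integral (\<lambda>z. \<phi> z + \<psi> z) (\<lambda>z. \<phi> z + \<psi> z) - value_integral (\<lambda>z. \<phi> z - \<psi> z) (\<lambda>z. \<phi> z - \<psi> z)) / 4)"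
      by (intro sums_divide sums_diff diag p m)
    moreover have "((?I (\<lambda>z. \<phi> z + \<psi> z) n)\<^sup>2 - (?I (\<lambda>z. \<phi> z - \<psi> z) n)\<^sup>2) / 4 = ?I \<phi> n * ?I \<psi> n" for n
      using q_int[OF \<phi>, of n] q_int[OF \<psi>, of n]
      by (simp add: distrib_right left_diff_distrib power2_eq_square algebra_simps)
    ultimately show "(\<lambda>n. ?I \<phi> n * ?I \<psi> n) sums value_integral \<phi> \<psi>"
      by (simp add: value_integral_polarization[OF \<phi> \<psi>, symmetric])
  qed
qed

end

section \<open>Absorbing the weight\<close>

lemma (in stable_transport) w_pos_lborel: "AE x in lborel. x \<in> \<Omega> \<longrightarrow> 0 < w x"
  using w_pos by (simp add: AE_N_iff)

text \<open>
Absorbs the weight, so that pairings become integrals with respect to Lebesgue measure.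
\<close>
definition (in stable_transport) represents :: "(real^'n \<Rightarrow> real) \<Rightarrow> (real^'n \<Rightarrow> real) \<Rightarrow> bool" where
  "represents h \<phi> \<longleftrightarrow> h \<in> borel_measurable borel \<and> (\<forall>x. x \<notin> \<Omega> \<longrightarrow> h x = 0) \<and>
     (AE x in lborel. x \<in> \<Omega> \<longrightarrow> \<phi> x * w x = h x)"

context stable_transport
begin

lemma representsD:
  assumes "represents h \<phi>"
  shows "h \<in> borel_measurable borel" "x \<notin> \<Omega> \<Longrightarrow> h x = 0"
    "AE x in lborel. x \<in> \<Omega> \<longrightarrow> \<phi> x * w x = h x"
  using assms by (auto simp: represents_def)

lemma represents_exists:
  assumes "\<phi> \<in> borel_measurable N"
  obtains h where "represents h \<phi>"
proof -
  have "(\<lambda>x. \<phi> x * w x) \<in> borel_measurable N"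
    using assms by simp
  from lebesgue_on_borel_version[OF \<Omega>_borel this]
  obtain h where h: "h \<in> borel_measurable borel" "AE x in lborel. x \<in> \<Omega> \<longrightarrow> \<phi> x * w x = h x"
    by blast
  have "represents (\<lambda>x. indicator \<Omega> x * h x) \<phi>"
    unfolding represents_def using h(1)
    by (intro conjI) (use h(2) in \<open>auto elim!: eventually_mono\<close>)
  then show ?thesis by (rule that)
qed

lemma represents_divide:
  assumes h [measurable]: "h \<in> borel_measurable borel" and out: "\<And>x. x \<notin> \<Omega> \<Longrightarrow> h x = 0"
  shows "(\<lambda>x. h x / w x) \<in> borel_measurable N" "represents h (\<lambda>x. h x / w x)"
proof -
  note [measurable] = borel_measurable_N[OF h]
  show "(\<lambda>x. h x / w x) \<in> borel_measurable N" by measurable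
  show "represents h (\<lambda>x. h x / w x)"
    unfolding represents_def using h out w_pos_lborel by (auto elim!: eventually_mono)
qed

lemma pairing_represented:
  assumes "represents h \<phi>" "represents k \<psi>"
  shows "pairing \<Omega> w \<phi> \<psi> = (LINT x|lborel. h x * k x)"
proof -
  note h = representsD[OF assms(1)] and k = representsD[OF assms(2)]
  have "pairing \<Omega> w \<phi> \<psi> = (LINT x|lborel. indicator \<Omega> x * (h x * k x))"
    unfolding pairing_def
  proof (rule integral_lebesgue_on_eq_lborel[OF \<Omega>_borel])
    show "(\<lambda>x. h x * k x) \<in> borel_measurable borel" using h(1) k(1) by simp
    show "AE x in lborel. x \<in> \<Omega> \<longrightarrow> \<phi> x * \<psi> x * (w x)\<^sup>2 = h x * k x"
      using h(3) k(3)
    proof eventually_elim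
      case (elim x)
      then show ?case by (metis power2_eq_square mult.assoc mult.left_commute)
    qed
  qed
  also have "\<dots> = (LINT x|lborel. h x * k x)"
    using h(2) by (intro Bochner_Integration.integral_cong) (auto simp: indicator_def)
  finally show ?thesis .
qed

lemma wLp_1_represented:
  assumes "represents h \<phi>" "\<phi> \<in> borel_measurable N"
  shows "\<phi> \<in> wLp 1 \<Omega> w \<longleftrightarrow> integrable lborel h"
proof -
  note h = representsD[OF assms(1)]
  have [measurable]: "h \<in> borel_measurable borel" by (rule h(1))
  have "integrable N (\<lambda>x. \<bar>\<phi> x\<bar> * w x) \<longleftrightarrow> integrable lborel (\<lambda>x. indicator \<Omega> x * \<bar>h x\<bar>)"
  proof (rule integrable_lebesgue_on_iff_lborel[OF \<Omega>_borel])
    show "AE x in lborel. x \<in> \<Omega> \<longrightarrow> \<bar>\<phi> x\<bar> * w x = \<bar>h x\<bar>"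
      using h(3) w_pos_lborel
    proof eventually_elim
      case (elim x)
      show ?case
      proof
        assume "x \<in> \<Omega>"
        with elim have "\<phi> x * w x = h x" "0 < w x" by auto
        then show "\<bar>\<phi> x\<bar> * w x = \<bar>h x\<bar>" by (metis abs_mult abs_of_pos)
      qed
    qed
  qed simp
  also have "(\<lambda>x. indicator \<Omega> x * \<bar>h x\<bar>) = (\<lambda>x. \<bar>h x\<bar>)"
    using h(2) by (auto simp: indicator_def fun_eq_iff)
  also have "integrable lborel (\<lambda>x. \<bar>h x\<bar>) \<longleftrightarrow> integrable lborel h"
    by (rule integrable_abs_iff) simp
  finally show ?thesis
    using assms(2) by (simp add: wLp_1_iff)
qed

lemma wLp_2_norm_represented:
  assumes "represents h \<phi>"
  shows "(wLp_norm 2 \<Omega> (\<lambda>x. (w x)\<^sup>2) \<phi>)\<^sup>2 = (LINT x|lborel. (h x)\<^sup>2)"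
proof -
  note h = representsD[OF assms]
  have [measurable]: "h \<in> borel_measurable borel" by (rule h(1))
  have "(LINT x|N. \<bar>\<phi> x\<bar> powr 2 * (w x)\<^sup>2) = (LINT x|lborel. indicator \<Omega> x * (h x)\<^sup>2)"
  proof (rule integral_lebesgue_on_eq_lborel[OF \<Omega>_borel])
    show "AE x in lborel. x \<in> \<Omega> \<longrightarrow> \<bar>\<phi> x\<bar> powr 2 * (w x)\<^sup>2 = (h x)\<^sup>2"
      using h(3)
    proof eventually_elim
      case (elim x)
      have "\<bar>\<phi> x\<bar> powr 2 = (\<phi> x)\<^sup>2" by simp
      then show ?case using elim by (metis power_mult_distrib)
    qed
  qed simp
  also have "(\<lambda>x. indicator \<Omega> x * (h x)\<^sup>2) = (\<lambda>x. (h x)\<^sup>2)"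
    using h(2) by (auto simp: indicator_def fun_eq_iff)
  finally have "wLp_norm 2 \<Omega> (\<lambda>x. (w x)\<^sup>2) \<phi> = sqrt (LINT x|lborel. (h x)\<^sup>2)"
    by (simp add: wLp_norm_def powr_half_sqrt)
  then show ?thesis by simp
qed

lemma wLinf_represented_L2:
  assumes "represents h \<phi>" "\<phi> \<in> wLinf \<Omega> w"
  shows "h \<in> L2 lborel"
proof -
  note h = representsD[OF assms(1)]
  have [measurable]: "h \<in> borel_measurable borel" by (rule h(1))
  define C where "C = wLinf_norm \<Omega> w \<phi>"
  have "AE x in lborel. x \<in> \<Omega> \<longrightarrow> \<bar>\<phi> x * w x\<bar> \<le> C"
    using wLinf_AE[OF assms(2)] by (simp add: AE_N_iff C_def)
  then have bound: "AE x in lborel. (h x)\<^sup>2 \<le> C\<^sup>2 * indicator \<Omega> x"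
    using h(3)
  proof eventually_elim
    case (elim x)
    show ?case
    proof (cases "x \<in> \<Omega>")
      case True
      then have "\<bar>h x\<bar> \<le> C" using elim by simp
      then have "\<bar>h x\<bar>\<^sup>2 \<le> C\<^sup>2" by (rule power_mono) simp
      then show ?thesis using True by simp
    qed (simp add: h(2))
  qed
  have "emeasure lborel \<Omega> < \<infinity>" by (rule emeasure_bounded_finite[OF bounded_\<Omega>])
  then have "integrable lborel (\<lambda>x. C\<^sup>2 * indicator \<Omega> x)"
    by (intro integrable_mult_right) (simp add: integrable_indicator_iff)
  then have "integrable lborel (\<lambda>x. (h x)\<^sup>2)"
    by (rule Bochner_Integration.integrable_bound) (use bound in \<open>auto elim!: eventually_mono\<close>)
  then show ?thesis by (simp add: L2_def)
qed

end

section \<open>The Lyapunov function as a diagonal\<close>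

text \<open>
Off the exceptional set \<open>Bad\<close>, the kernel is the one that the flow and the cost generate.
\<close>
locale observed_transport =
  stable_transport \<Omega> w \<Phi> S K +
  square_summable_kernel D \<Omega> "\<lambda>t. indicator {0..} t * K t" \<kappa>
  for \<Omega> :: "(real^'n) set" and w \<Phi> S K and D :: "nat \<Rightarrow> real \<times> (real^'n) \<Rightarrow> real" and \<kappa> +
  fixes c :: "nat \<Rightarrow> real^'n \<Rightarrow> real" and g :: "real^'n \<Rightarrow> real" and Bad :: "(real \<times> (real^'n)) set"
  assumes cost: "nuclear_cost \<Omega> w c g"
    and Bad_borel: "Bad \<in> sets borel"
    and Bad_null: "\<And>t. 0 \<le> t \<Longrightarrow> AE z in lborel. z \<in> \<Omega> \<longrightarrow> (t, z) \<notin> Bad"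
    and kernel_eq: "\<And>t z. 0 \<le> t \<Longrightarrow> z \<in> \<Omega> \<Longrightarrow> (t, z) \<notin> Bad \<Longrightarrow>
        \<Phi> t z \<in> \<Omega> \<and> 0 < w z \<and> (\<forall>i. D i (t, z) = c i (\<Phi> t z) * w z)"
begin

lemma kernel_represents:
  assumes "0 \<le> t"
  shows "represents (\<lambda>z. D i (t, z)) (c i \<circ> \<Phi> t)"
  unfolding represents_def
proof (intro conjI allI impI)
  show "AE z in lborel. z \<in> \<Omega> \<longrightarrow> (c i \<circ> \<Phi> t) z * w z = D i (t, z)"
    using Bad_null[OF assms] by eventually_elim (use kernel_eq[OF assms] in auto)
qed (simp_all add: D_outside)

lemma observation_eq_out:
  assumes "\<phi> \<in> wLp 1 \<Omega> w" "represents h \<phi>" "0 \<le> t"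
  shows "observation \<Omega> w c (S t \<phi>) i = out i h t"
proof -
  have "c i \<in> wLinf \<Omega> w" using cost by (simp add: nuclear_cost_def)
  then have "observation \<Omega> w c (S t \<phi>) i = pairing \<Omega> w \<phi> (c i \<circ> \<Phi> t)"
    using preadj assms by (simp add: observation_def preadjoint_semigroup_def)
  also have "\<dots> = out i h t"
    unfolding out_def by (rule pairing_represented[OF assms(2) kernel_represents[OF assms(3)]])
  finally show ?thesis .
qed

lemma out_negative: "t < 0 \<Longrightarrow> out i h t = 0"
  using D_bound[of i t] by (simp add: out_def)

lemma value_form_eq:
  assumes "\<phi> \<in> wLp 1 \<Omega> w" "represents h \<phi>" "\<psi> \<in> wLp 1 \<Omega> w" "represents k \<psi>"
  shows "value_form \<Omega> w c S \<phi> \<psi> = value_integral h k"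
proof -
  note [measurable] = representsD(1)[OF assms(2)] representsD(1)[OF assms(4)]
  have "value_form \<Omega> w c S \<phi> \<psi> = (LINT t|lborel. indicator {0..} t * (\<Sum>i. out i h t * out i k t))"
    unfolding value_form_def
  proof (rule integral_lebesgue_on_eq_lborel)
    show "AE t in lborel. t \<in> {0..} \<longrightarrow>
        (\<Sum>i. observation \<Omega> w c (S t \<phi>) i * observation \<Omega> w c (S t \<psi>) i) = (\<Sum>i. out i h t * out i k t)"
      using assms by (intro AE_I2) (simp add: observation_eq_out)
    show "(\<lambda>t. \<Sum>i. out i h t * out i k t) \<in> borel_measurable borel" by measurable
  qed simp
  also have "(\<lambda>t. indicator {0..} t * (\<Sum>i. out i h t * out i k t)) = (\<lambda>t. \<Sum>i. out i h t * out i k t)"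
    by (auto simp: indicator_def fun_eq_iff out_negative)
  finally show ?thesis by (simp add: value_integral_def)
qed

lemma sos_decomposition_exists: "\<exists>p. sos_decomposition \<Omega> w c S p"
proof -
  obtain q C where q: "\<And>n. q n \<in> borel_measurable borel" "\<And>n z. \<bar>q n z\<bar> \<le> C n * indicator \<Omega> z"
    "summable (\<lambda>n. LINT z|lborel. (q n z)\<^sup>2)"
    "\<And>\<phi> \<psi>. integrable lborel \<phi> \<Longrightarrow> integrable lborel \<psi> \<Longrightarrow>
      (\<lambda>n. (LINT z|lborel. \<phi> z * q n z) * (LINT z|lborel. \<psi> z * q n z)) sums value_integral \<phi> \<psi>"
    using decomposition_exists by blast
  have q_out: "q n z = 0" if "z \<notin> \<Omega>" for n z
    using q(2)[of n z] that by simp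
  define p where "p n x = q n x / w x" for n x
  have p_meas: "p n \<in> borel_measurable N" and rep: "represents (q n) (p n)" for n
    using represents_divide[OF q(1) q_out] by (simp_all add: p_def[abs_def])
  have "p n \<in> wLinf \<Omega> w" for n
  proof (rule wLinfI[OF p_meas w_meas])
    have bound: "\<bar>q n x\<bar> \<le> C n" if "x \<in> \<Omega>" for x
      using q(2)[of n x] that by simp
    show "AE x in N. \<bar>p n x * w x\<bar> \<le> C n"
      unfolding AE_N_iff using representsD(3)[OF rep[of n]]
      by eventually_elim (simp add: bound)
  qed
  moreover have "summable (\<lambda>n. (wLp_norm 2 \<Omega> (\<lambda>x. (w x)\<^sup>2) (p n))\<^sup>2)"
    using q(3) by (simp add: wLp_2_norm_represented[OF rep])
  moreover have "(\<lambda>n. pairing \<Omega> w \<phi> (p n) * pairing \<Omega> w \<psi> (p n)) sums value_form \<Omega> w c S \<phi> \<psi>"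
    if \<phi>: "\<phi> \<in> wLp 1 \<Omega> w" and \<psi>: "\<psi> \<in> wLp 1 \<Omega> w" for \<phi> \<psi>
  proof -
    have m: "\<phi> \<in> borel_measurable N" "\<psi> \<in> borel_measurable N"
      using that by (simp_all add: wLp_1_iff)
    obtain h where h: "represents h \<phi>" using represents_exists[OF m(1)] .
    obtain k where k: "represents k \<psi>" using represents_exists[OF m(2)] .
    have "integrable lborel h" "integrable lborel k"
      using wLp_1_represented[OF h m(1)] wLp_1_represented[OF k m(2)] \<phi> \<psi> by simp_all
    then show ?thesis
      unfolding value_form_eq[OF \<phi> h \<psi> k] pairing_represented[OF h rep] pairing_represented[OF k rep]
      by (rule q(4))
  qed
  ultimately show ?thesis
    unfolding sos_decomposition_def by blast
qed

lemma sos_diagonal: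
  assumes p: "sos_decomposition \<Omega> w c S p"
  shows "AE z in lborel. z \<in> \<Omega> \<longrightarrow> (\<Sum>i. ennreal ((p i z * w z)\<^sup>2)) = gram_trace z"
proof -
  have p_inf: "p i \<in> wLinf \<Omega> w" for i
    using p by (simp add: sos_decomposition_def)
  then have "\<exists>P. represents P (p i)" for i
    using represents_exists[of "p i"] by (auto simp: wLinf_def)
  then obtain P where P: "\<And>i. represents (P i) (p i)" by metis
  have "AE z in lborel. (\<Sum>i. ennreal ((P i z)\<^sup>2)) = gram_trace z"
  proof (rule diagonal_unique)
    show "P i \<in> L2 lborel" for i by (rule wLinf_represented_L2[OF P p_inf])
    show "P i z = 0" if "z \<notin> \<Omega>" for i z by (rule representsD(2)[OF P that])
    fix h :: "real^'n \<Rightarrow> real" assume h: "integrable lborel h" and out: "\<And>z. z \<notin> \<Omega> \<Longrightarrow> h z = 0"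
    have hb: "h \<in> borel_measurable borel" using borel_measurable_integrable[OF h] by simp
    let ?\<phi> = "\<lambda>x. h x / w x"
    note rep = represents_divide[OF hb out]
    have \<phi>: "?\<phi> \<in> wLp 1 \<Omega> w"
      using wLp_1_represented[OF rep(2,1)] h by simp
    then have "(\<lambda>i. pairing \<Omega> w ?\<phi> (p i) * pairing \<Omega> w ?\<phi> (p i)) sums value_form \<Omega> w c S ?\<phi> ?\<phi>"
      using p by (simp add: sos_decomposition_def)
    moreover have "value_form \<Omega> w c S ?\<phi> ?\<phi> = value_integral h h"
      by (rule value_form_eq[OF \<phi> rep(2) \<phi> rep(2)])
    moreover have "pairing \<Omega> w ?\<phi> (p i) = (LINT z|lborel. h z * P i z)" for i
      by (rule pairing_represented[OF rep(2) P])
    ultimately show "(\<lambda>i. (LINT z|lborel. h z * P i z)\<^sup>2) sums value_integral h h"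
      by (simp add: power2_eq_square)
  qed
  moreover have "AE z in lborel. \<forall>i. z \<in> \<Omega> \<longrightarrow> p i z * w z = P i z"
    unfolding AE_all_countable using representsD(3)[OF P] by blast
  ultimately show ?thesis
    by eventually_elim simp
qed

text \<open>
By Fubini's theorem, for almost every \<open>z\<close> the kernel is \<open>c i (\<Phi> t z) w z\<close> at almost every time, and
the squares of these values sum to \<open>g (\<Phi> t z) w z\<^sup>2\<close>.
\<close>
lemma lyapunov_gram_trace:
  "AE z in lborel. z \<in> \<Omega> \<longrightarrow> 0 < w z \<and> integrable (lebesgue_on {0..}) (\<lambda>t. g (\<Phi> t z)) \<and>
     0 \<le> lyapunov_function g \<Phi> z \<and> ennreal (lyapunov_function g \<Phi> z * (w z)\<^sup>2) = gram_trace z"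
proof -
  have "{p \<in> space (lborel \<Otimes>\<^sub>M lborel). 0 \<le> fst p \<longrightarrow> snd p \<in> \<Omega> \<longrightarrow> (fst p, snd p) \<notin> Bad}
      = - (({0..} \<times> \<Omega>) \<inter> Bad)"
    by (auto simp: space_pair_measure)
  also have "\<dots> \<in> sets (lborel \<Otimes>\<^sub>M lborel)"
    unfolding lborel_prod sets_lborel using Bad_borel
    by (intro borel_comp sets.Int borel_Times \<Omega>_borel) simp_all
  finally have exceptional: "{p \<in> space (lborel \<Otimes>\<^sub>M lborel).
      0 \<le> fst p \<longrightarrow> snd p \<in> \<Omega> \<longrightarrow> (fst p, snd p) \<notin> Bad} \<in> sets (lborel \<Otimes>\<^sub>M lborel)" .
  have "AE t in lborel. AE z in lborel. 0 \<le> t \<longrightarrow> z \<in> \<Omega> \<longrightarrow> (t, z) \<notin> Bad"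
  proof (rule AE_I2)
    show "AE z in lborel. 0 \<le> t \<longrightarrow> z \<in> \<Omega> \<longrightarrow> (t, z) \<notin> Bad" for t
      using Bad_null[of t] by (cases "0 \<le> t") simp_all
  qed
  then have "AE z in lborel. AE t in lborel. 0 \<le> t \<longrightarrow> z \<in> \<Omega> \<longrightarrow> (t, z) \<notin> Bad"
    by (subst (asm) lborel_pair.AE_commute[OF exceptional])
  with w_pos_lborel show ?thesis
  proof eventually_elim
    case (elim z)
    show ?case
    proof
      assume z: "z \<in> \<Omega>"
      with elim have w: "0 < w z" and good: "AE t in lborel. 0 \<le> t \<longrightarrow> (t, z) \<notin> Bad" by auto
      define G where "G t = (\<Sum>i. (D i (t, z))\<^sup>2)" for t
      have [measurable]: "G \<in> borel_measurable borel" unfolding G_def[abs_def] by measurable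
      have sm: "summable (\<lambda>i. (D i (t, z))\<^sup>2)" for t
      proof (rule summable_comparison_test'[OF summable_mult[OF \<kappa>_summable, of "(indicator {0..} t * K t)\<^sup>2"]])
        fix i
        have "\<bar>D i (t, z)\<bar>\<^sup>2 \<le> (indicator {0..} t * K t * \<kappa> i)\<^sup>2"
          by (intro power_mono D_bound) simp
        then show "norm ((D i (t, z))\<^sup>2) \<le> (indicator {0..} t * K t)\<^sup>2 * (\<kappa> i)\<^sup>2"
          by (simp add: power_mult_distrib)
      qed
      have G_nonneg: "0 \<le> G t" for t unfolding G_def by (intro suminf_nonneg sm) simp
      have G_neg: "G t = 0" if "t < 0" for t
        using D_bound[of _ t z] that by (simp add: G_def)
      have G_trace: "(\<integral>\<^sup>+t. ennreal (G t) \<partial>lborel) = gram_trace z"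
        unfolding gram_trace_def G_def
        by (intro nn_integral_cong suminf_ennreal_eq[symmetric]) (auto intro: summable_sums sm)
      then have fin: "(\<integral>\<^sup>+t. ennreal (G t) \<partial>lborel) < \<infinity>"
        using gram_trace_bound[of z] by (auto intro: le_less_trans)
      have G_int: "integrable lborel G"
        using fin G_nonneg by (intro integrableI_nonneg) auto
      have gG: "AE t in lborel. t \<in> {0..} \<longrightarrow> g (\<Phi> t z) = G t / (w z)\<^sup>2"
        using good
      proof eventually_elim
        case (elim t)
        show ?case
        proof
          assume "t \<in> {0..}"
          then have t: "0 \<le> t" "(t, z) \<notin> Bad" using elim by auto
          note k = kernel_eq[OF t(1) z t(2)]
          have "(\<lambda>i. (c i (\<Phi> t z))\<^sup>2) sums g (\<Phi> t z)"
            using cost k by (simp add: nuclear_cost_def)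
          from sums_mult2[OF this, of "(w z)\<^sup>2"] have "(\<lambda>i. (D i (t, z))\<^sup>2) sums (g (\<Phi> t z) * (w z)\<^sup>2)"
            using k by (simp add: power_mult_distrib)
          then have "G t = g (\<Phi> t z) * (w z)\<^sup>2"
            unfolding G_def by (rule sums_unique[symmetric])
          then show "g (\<Phi> t z) = G t / (w z)\<^sup>2" using w by simp
        qed
      qed
      have "(\<lambda>t. G t / (w z)\<^sup>2) \<in> borel_measurable borel" by measurable
      note transfer = lebesgue_on_to_lborel[OF _ this gG]
      have ind: "(\<lambda>t. indicator {0..} t * (G t / (w z)\<^sup>2)) = (\<lambda>t. G t / (w z)\<^sup>2)"
        using G_neg by (auto simp: indicator_def fun_eq_iff)
      have int: "integrable (lebesgue_on {0..}) (\<lambda>t. g (\<Phi> t z))"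
        using G_int by (subst transfer(2)) (simp, simp only: ind, simp)
      have lyap: "lyapunov_function g \<Phi> z = integral\<^sup>L lborel G / (w z)\<^sup>2"
        unfolding lyapunov_function_def by (subst transfer(1)) (simp, simp only: ind, simp)
      have nonneg: "0 \<le> lyapunov_function g \<Phi> z"
        unfolding lyap by (intro divide_nonneg_nonneg Bochner_Integration.integral_nonneg G_nonneg) simp
      have "lyapunov_function g \<Phi> z * (w z)\<^sup>2 = integral\<^sup>L lborel G"
        unfolding lyap using w by simp
      moreover have "ennreal (integral\<^sup>L lborel G) = gram_trace z"
        unfolding G_trace[symmetric] using G_int G_nonneg by (intro nn_integral_eq_integral[symmetric]) auto
      ultimately have "ennreal (lyapunov_function g \<Phi> z * (w z)\<^sup>2) = gram_trace z"
        by (simp only:)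
      with w int nonneg show "0 < w z \<and> integrable (lebesgue_on {0..}) (\<lambda>t. g (\<Phi> t z)) \<and>
          0 \<le> lyapunov_function g \<Phi> z \<and> ennreal (lyapunov_function g \<Phi> z * (w z)\<^sup>2) = gram_trace z"
        by (intro conjI)
    qed
  qed
qed

lemma lyapunov_sum_of_squares:
  assumes "sos_decomposition \<Omega> w c S p"
  shows "AE z in N. (\<lambda>i. (p i z)\<^sup>2) sums lyapunov_function g \<Phi> z"
  unfolding AE_N_iff using sos_diagonal[OF assms] lyapunov_gram_trace
proof eventually_elim
  case (elim z)
  show ?case
  proof
    assume z: "z \<in> \<Omega>"
    with elim(2) have w: "0 < w z" and nonneg: "0 \<le> lyapunov_function g \<Phi> z"
      and trace: "ennreal (lyapunov_function g \<Phi> z * (w z)\<^sup>2) = gram_trace z"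
      by blast+
    have eq: "(\<Sum>i. ennreal ((p i z * w z)\<^sup>2)) = ennreal (lyapunov_function g \<Phi> z * (w z)\<^sup>2)"
      by (rule trans[OF mp[OF elim(1) z] trace[symmetric]])
    have "(\<lambda>i. ennreal ((p i z * w z)\<^sup>2)) sums ennreal (lyapunov_function g \<Phi> z * (w z)\<^sup>2)"
      unfolding eq[symmetric] by (rule summable_sums) simp
    then have "(\<lambda>i. (p i z * w z)\<^sup>2) sums (lyapunov_function g \<Phi> z * (w z)\<^sup>2)"
      using nonneg by (subst (asm) sums_ennreal) auto
    from sums_divide[OF this, of "(w z)\<^sup>2"]
    show "(\<lambda>i. (p i z)\<^sup>2) sums lyapunov_function g \<Phi> z"
      using w by (simp add: power_mult_distrib)
  qed
qed

lemma lyapunov_wLinf: "lyapunov_function g \<Phi> \<in> wLinf \<Omega> (\<lambda>x. (w x)\<^sup>2)"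
proof -
  obtain W where W [measurable]: "W \<in> borel_measurable borel" and wW: "AE x in lborel. x \<in> \<Omega> \<longrightarrow> w x = W x"
    using lebesgue_on_borel_version[OF \<Omega>_borel w_meas] .
  show ?thesis
  proof (rule wLinfI)
    show "lyapunov_function g \<Phi> \<in> borel_measurable N"
    proof (rule measurable_lebesgue_on_AE[OF \<Omega>_borel])
      show "(\<lambda>z. enn2real (gram_trace z) / (W z)\<^sup>2) \<in> borel_measurable borel" by measurable
      show "AE z in lborel. z \<in> \<Omega> \<longrightarrow> lyapunov_function g \<Phi> z = enn2real (gram_trace z) / (W z)\<^sup>2"
        using lyapunov_gram_trace wW
      proof eventually_elim
        case (elim z)
        show ?case
        proof
          assume "z \<in> \<Omega>"
          with elim have w: "0 < w z" "w z = W z" and l: "0 \<le> lyapunov_function g \<Phi> z"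
            and trace: "ennreal (lyapunov_function g \<Phi> z * (w z)\<^sup>2) = gram_trace z" by blast+
          show "lyapunov_function g \<Phi> z = enn2real (gram_trace z) / (W z)\<^sup>2"
            unfolding trace[symmetric] using w l by simp
        qed
      qed
    qed
    show "(\<lambda>x. (w x)\<^sup>2) \<in> borel_measurable N" by measurable
    let ?B = "(\<Sum>i. (\<kappa> i)\<^sup>2) * L2_inner lborel (\<lambda>t. indicator {0..} t * K t) (\<lambda>t. indicator {0..} t * K t)"
    have B: "0 \<le> ?B"
      by (intro mult_nonneg_nonneg suminf_nonneg \<kappa>_summable L2_inner_nonneg) simp
    show "AE z in N. \<bar>lyapunov_function g \<Phi> z * (w z)\<^sup>2\<bar> \<le> ?B"
      unfolding AE_N_iff using lyapunov_gram_trace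
    proof eventually_elim
      case (elim z)
      show ?case
      proof
        assume "z \<in> \<Omega>"
        with elim have l: "0 \<le> lyapunov_function g \<Phi> z"
          and trace: "ennreal (lyapunov_function g \<Phi> z * (w z)\<^sup>2) = gram_trace z" by blast+
        have "ennreal (lyapunov_function g \<Phi> z * (w z)\<^sup>2) \<le> ennreal ?B"
          unfolding trace by (rule gram_trace_bound)
        then show "\<bar>lyapunov_function g \<Phi> z * (w z)\<^sup>2\<bar> \<le> ?B"
          using l B by (simp add: ennreal_le_iff)
      qed
    qed
  qed
qed

end

lemma decaying_exp_L2:
  assumes "\<omega> < 0"
  shows "(\<lambda>t. indicator {0..} t * (M * exp (\<omega> * t))) \<in> L2 lborel"
proof -
  let ?f = "\<lambda>t::real. indicator {0..} t * exp (2 * \<omega> * t)"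
  have "((\<lambda>t. exp (- (- 2 * \<omega>) * t)) has_integral exp (- (- 2 * \<omega>) * 0) / (- 2 * \<omega>)) {0..}"
    using assms by (intro has_integral_exp_minus_to_infinity) simp
  then have "(?f has_integral (1 / (- 2 * \<omega>))) UNIV"
    by (subst (asm) has_integral_restrict_UNIV[symmetric])
       (auto simp: indicator_def of_bool_def if_distrib[of "\<lambda>x. x * _"] cong: if_cong)
  then have "integral\<^sup>N lborel (\<lambda>t. ennreal (?f t)) = ennreal (1 / (- 2 * \<omega>))"
    by (intro nn_integral_has_integral_lborel) auto
  then have "integrable lborel ?f"
    by (intro integrableI_nonneg) auto
  then have "integrable lborel (\<lambda>t. M\<^sup>2 * ?f t)" by simp
  also have "(\<lambda>t. M\<^sup>2 * ?f t) = (\<lambda>t. (indicator {0..} t * (M * exp (\<omega> * t)))\<^sup>2)"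
    by (auto simp: fun_eq_iff power_mult_distrib indicator_def exp_double[symmetric] mult.assoc)
  finally show ?thesis by (simp add: L2_def)
qed

theorem theorem3p10:
  fixes \<Omega> :: "(real^'n) set"
    and \<nu> :: "real^'n \<Rightarrow> real^'n"
    and f :: "real^'n \<Rightarrow> real^'n"
    and w :: "real^'n \<Rightarrow> real"
    and \<Phi> :: "real \<Rightarrow> real^'n \<Rightarrow> real^'n"
    and S :: "real \<Rightarrow> (real^'n \<Rightarrow> real) \<Rightarrow> (real^'n \<Rightarrow> real)"
    and c :: "nat \<Rightarrow> real^'n \<Rightarrow> real"
    and g :: "real^'n \<Rightarrow> real"
    and \<omega>0 :: real
  assumes "\<Omega> \<noteq> {}" and "open \<Omega>" and "connected \<Omega>" and "bounded \<Omega>" and "C1_boundary \<Omega>"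
    and "\<forall>x\<in>frontier \<Omega>. outer_unit_normal \<Omega> x (\<nu> x)"
    and "C1_on UNIV f"
    and "\<forall>x\<in>frontier \<Omega>. \<nu> x \<bullet> f x \<le> 0"
    and "w \<in> borel_measurable (lebesgue_on \<Omega>)"
    and "\<forall>x\<in>\<Omega>. 0 \<le> w x"
    and "AE x in lebesgue_on \<Omega>. 0 < w x"
    and "(\<lambda>x. inverse (w x)) \<in> W1inf \<Omega>"
    and "\<forall>i. (\<lambda>x. f x $ i) \<in> wLinf \<Omega> w \<and> C1_on (closure \<Omega>) (\<lambda>x. f x $ i)"
    and "esssup (lebesgue_on \<Omega>) (\<lambda>x. ereal (- ((f x \<bullet> weight_gradient \<Omega> w x) / w x))) < \<infinity>"
    and "is_flow_on f (closure \<Omega>) \<Phi>"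
    and "preadjoint_semigroup \<Omega> w \<Phi> S"
    and "nuclear_cost \<Omega> w c g"
    and "\<omega>0 < 0" and "X_exp_stable \<Omega> w S \<omega>0"
  shows "(AE z in lebesgue_on \<Omega>. integrable (lebesgue_on {0..}) (\<lambda>t. g (\<Phi> t z)))
    \<and> (\<exists>p. sos_decomposition \<Omega> w c S p)
    \<and> (\<forall>p. sos_decomposition \<Omega> w c S p \<longrightarrow>
          (AE z in lebesgue_on \<Omega>. (\<lambda>i. (p i z)\<^sup>2) sums lyapunov_function g \<Phi> z))
    \<and> lyapunov_function g \<Phi> \<in> wLinf \<Omega> (\<lambda>x. (w x)\<^sup>2)"
proof -
  obtain M where M: "1 \<le> M" "\<And>t. 0 \<le> t \<Longrightarrow> X_opnorm \<Omega> w (S t) \<le> ereal (M * exp (\<omega>0 * t))"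
    using assms(19) by (auto simp: X_exp_stable_def)
  define K where "K t = M * exp (\<omega>0 * t)" for t
  have K_nonneg: "0 \<le> K t" for t using M(1) by (simp add: K_def)
  have flow_cont: "continuous_on ({0..} \<times> \<Omega>) (\<lambda>(t, z). \<Phi> t z)"
    by (rule continuous_on_subset[OF flow_continuous_on[OF assms(7) assms(15)]])
       (use closure_subset in auto)
  interpret stable_transport \<Omega> w \<Phi> S K
  proof
    show "K \<in> borel_measurable borel" by (simp add: K_def[abs_def])
    show "(\<lambda>x. inverse (w x)) \<in> wLinf \<Omega> (\<lambda>_. 1)" using assms(12) by (simp add: W1inf_def)
  qed (use assms flow_cont M(2) in \<open>auto simp: K_def\<close>)
  \<comment> \<open>The absolute value does not change the norm and makes its sign evident.\<close>
  define \<kappa> where "\<kappa> i = \<bar>wLinf_norm \<Omega> w (c i)\<bar>" for i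
  have c_inf: "c i \<in> wLinf \<Omega> w" for i
    using assms(17) by (simp add: nuclear_cost_def)
  have c_bound: "AE x in lebesgue_on \<Omega>. \<bar>c i x * w x\<bar> \<le> \<kappa> i" for i
    using wLinf_AE[OF c_inf[of i]] by eventually_elim (simp add: \<kappa>_def)
  obtain D Bad where D: "\<And>i. D i \<in> borel_measurable borel" "Bad \<in> sets borel"
    "\<And>t. 0 \<le> t \<Longrightarrow> AE z in lborel. z \<in> \<Omega> \<longrightarrow> (t, z) \<notin> Bad"
    "\<And>i t z. \<bar>D i (t, z)\<bar> \<le> indicator {0..} t * K t * \<kappa> i"
    "\<And>i t z. z \<notin> \<Omega> \<Longrightarrow> D i (t, z) = 0"
    "\<And>t z. 0 \<le> t \<Longrightarrow> z \<in> \<Omega> \<Longrightarrow> (t, z) \<notin> Bad \<Longrightarrow>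
        \<Phi> t z \<in> \<Omega> \<and> 0 < w z \<and> (\<forall>i. D i (t, z) = c i (\<Phi> t z) * w z)"
    by (rule trajectory_kernel[of c \<kappa>]) (use c_inf c_bound K_nonneg in \<open>auto simp: wLinf_def \<kappa>_def\<close>)
  interpret observed_transport \<Omega> w \<Phi> S K D \<kappa> c g Bad
  proof
    show "(\<lambda>t. indicator {0..} t * K t) \<in> L2 lborel"
      unfolding K_def by (rule decaying_exp_L2[OF assms(18)])
    show "summable (\<lambda>i. (\<kappa> i)\<^sup>2)"
      using assms(17) by (simp add: nuclear_cost_def \<kappa>_def)
    show "emeasure lborel \<Omega> < \<infinity>" by (rule emeasure_bounded_finite[OF assms(4)])
  qed (use D K_nonneg assms(2,17) in \<open>auto simp: \<kappa>_def\<close>)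
  have "AE z in lebesgue_on \<Omega>. integrable (lebesgue_on {0..}) (\<lambda>t. g (\<Phi> t z))"
    unfolding AE_N_iff using lyapunov_gram_trace by eventually_elim auto
  then show ?thesis
    using sos_decomposition_exists lyapunov_sum_of_squares lyapunov_wLinf by blast
qed

end
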